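(* Let $n,\gamma$ be positive integers and let $\mathscr{T}_{n,\gamma}$ be the set of all trees on $n$ vertices with domination number $\gamma$. For every $T\in\mathscr{T}_{n,\gamma}$, $$\xi^d(T)\ge 6n^2+\gamma^2+9\gamma n-22n-28\gamma+34,$$ with equality if and only if $T\cong T_{n,\gamma}$, where $T_{n,\gamma}$ is the tree obtained from the star $S_{n-\gamma+1}$ by attaching a pendant edge to each of $\gamma-1$ of its non-central vertices.
   Context: All graphs are simple and connected. For a graph $G$ and vertices $u,v$, $d_G(u,v)$ is the distance between $u$ and $v$; $D_G(v)=\sum_{u\in V_G}d_G(u,v)$; the eccentricity $\varepsilon_G(v)$ is the maximum distance from $v$ to any vertex. The eccentric distance sum is $\xi^d(G)=\sum_{v\in V_G}\varepsilon_G(v)D_G(v)$. A dominating set of $G$ is a set $S\subseteq V_G$ such that every vertex outside $S$ is adjacent to a vertex of $S$; the domination number $\gamma(G)$ is the minimum size of a dominating set.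
   Formalization: The formal theorem assumes γ ≥ 3 or n = 1; as printed the bound is false for γ = 1 with n ≥ 2 (e.g. the path P_3 gives 14 < 22) and for γ = 2, where T_{n,2} falls below it by 5n − 10 (P_4 gives 52 < 62). *)

theory Defs
  imports "Graph_Theory.Graph_Theory"
begin

text \<open>
  A finite simple graph is a \<^term>\<open>graph G\<close> of the library: finite, loop-free, without
  parallel arcs, each undirected edge being a pair of opposite arcs.

  The library predicates \<^const>\<open>forest\<close> and \<^const>\<open>tree\<close> are of no use for such graphs: they
  also forbid the directed cycle \<open>u, v, u\<close>, which every undirected edge gives rise to.
  A cycle of an undirected graph is a cycle with at least three arcs.
\<close>

definition undirected_tree :: "('a, 'b) pre_digraph \<Rightarrow> bool" where
  "undirected_tree G \<longleftrightarrow>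
     graph G \<and> connected G \<and> \<not> (\<exists>p. pre_digraph.cycle G p \<and> 3 \<le> length p)"

text \<open>Only meaningful when some walk joins \<open>u\<close> to \<open>v\<close>, as is the case in connected graphs.\<close>

definition graph_dist :: "('a, 'b) pre_digraph \<Rightarrow> 'a \<Rightarrow> 'a \<Rightarrow> nat" where
  "graph_dist G u v = (LEAST k. \<exists>p. pre_digraph.awalk G u p v \<and> length p = k)"

definition dist_sum :: "('a, 'b) pre_digraph \<Rightarrow> 'a \<Rightarrow> nat" where
  "dist_sum G v = (\<Sum>u\<in>verts G. graph_dist G u v)"

definition eccentricity :: "('a, 'b) pre_digraph \<Rightarrow> 'a \<Rightarrow> nat" where
  "eccentricity G v = Max ((\<lambda>u. graph_dist G v u) ` verts G)"

definition eccentric_distance_sum :: "('a, 'b) pre_digraph \<Rightarrow> nat" where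
  "eccentric_distance_sum G = (\<Sum>v\<in>verts G. eccentricity G v * dist_sum G v)"

definition dominating_set :: "('a, 'b) pre_digraph \<Rightarrow> 'a set \<Rightarrow> bool" where
  "dominating_set G S \<longleftrightarrow>
     S \<subseteq> verts G \<and> (\<forall>v \<in> verts G - S. \<exists>u \<in> S. v \<rightarrow>\<^bsub>G\<^esub> u)"

definition domination_number :: "('a, 'b) pre_digraph \<Rightarrow> nat" where
  "domination_number G = Min (card ` {S. dominating_set G S})"

definition trees_with_domination_number :: "nat \<Rightarrow> nat \<Rightarrow> ('a, 'b) pre_digraph set" where
  "trees_with_domination_number n \<gamma> =
     {T. undirected_tree T \<and> card (verts T) = n \<and> domination_number T = \<gamma>}"

text \<open>
  The star on \<open>n - \<gamma> + 1\<close> vertices has centre \<open>0\<close> and leaves \<open>1, \<dots>, n - \<gamma>\<close>; to each leaf \<open>i\<close>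
  with \<open>1 \<le> i \<le> \<gamma> - 1\<close> a new pendant vertex \<open>n - \<gamma> + i\<close> is attached.  This is the intended
  graph only for \<open>1 \<le> \<gamma>\<close> and \<open>2 * \<gamma> \<le> n + 1\<close>, so that the star has at least \<open>\<gamma> - 1\<close> leaves;
  every tree on \<open>n\<close> vertices with domination number \<open>\<gamma>\<close> satisfies these bounds.
\<close>

definition extremal_edges :: "nat \<Rightarrow> nat \<Rightarrow> (nat \<times> nat) set" where
  "extremal_edges n \<gamma> =
     {(0, i) | i. i \<in> {1..n - \<gamma>}} \<union> {(i, n - \<gamma> + i) | i. i \<in> {1..\<gamma> - 1}}"

definition extremal_tree :: "nat \<Rightarrow> nat \<Rightarrow> (nat, nat \<times> nat) pre_digraph" where
  "extremal_tree n \<gamma> =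
     \<lparr> verts = {0..<n}, arcs = extremal_edges n \<gamma> \<union> (extremal_edges n \<gamma>)\<inverse>,
       tail = fst, head = snd \<rparr>"

end

theory Submission
  imports Defs
begin

text \<open>
  If some vertex has eccentricity at most two, the tree is determined by the numbers \<open>a\<^sub>i\<close> of
  children of the neighbours \<open>i\<close> of that root, and the eccentric distance sum is an explicit
  polynomial minus \<open>8 * (\<Sum>i. a\<^sub>i\<^sup>2)\<close>.  The root and the neighbours with \<open>a\<^sub>i > 0\<close> dominate, so
  there are at least \<open>\<gamma> - 1\<close> such neighbours, and the minimum is attained exactly when \<open>\<gamma> - 1\<close> of
  the \<open>a\<^sub>i\<close> are one and the others zero.

  If all eccentricities are at least three, the vertices of eccentricity exactly three are pairwise
  adjacent, hence at most two in number, so the eccentric distance sum is almost four times the sum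
  of all distances.  The latter is large: at most \<open>\<Sum>v. deg v * (deg v - 1)\<close> ordered pairs are at
  distance two, and since the non-leaves dominate, there are at most \<open>n - \<gamma>\<close> leaves, which bounds
  \<open>\<Sum>v. deg v - 2\<close> over the non-leaves and hence the sum of the squared degrees.  With
  \<open>2 * \<gamma> \<le> n\<close> the bound is then strict.
\<close>

section \<open>Metric description of trees\<close>

text \<open>
  An edge \<open>xy\<close> splits the vertices into those closer to \<open>x\<close> and those closer to \<open>y\<close>: by \<open>d_parity\<close>
  there are no ties, and by \<open>d_bridge\<close> no other edge joins the two sides.
\<close>

locale tree_metric =
  fixes V :: "'a set" and d :: "'a \<Rightarrow> 'a \<Rightarrow> nat"
  assumes finite_V [simp]: "finite V"
    and d_eq_0_iff: "x \<in> V \<Longrightarrow> y \<in> V \<Longrightarrow> d x y = 0 \<longleftrightarrow> x = y"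
    and d_sym: "x \<in> V \<Longrightarrow> y \<in> V \<Longrightarrow> d x y = d y x"
    and d_triangle: "x \<in> V \<Longrightarrow> y \<in> V \<Longrightarrow> z \<in> V \<Longrightarrow> d x z \<le> d x y + d y z"
    and d_step: "x \<in> V \<Longrightarrow> y \<in> V \<Longrightarrow> x \<noteq> y \<Longrightarrow> \<exists>z\<in>V. d x z = 1 \<and> d x y = Suc (d z y)"
    and d_parity: "x \<in> V \<Longrightarrow> y \<in> V \<Longrightarrow> v \<in> V \<Longrightarrow> d x y = 1 \<Longrightarrow> d v x \<noteq> d v y"
    and d_bridge: "x \<in> V \<Longrightarrow> y \<in> V \<Longrightarrow> p \<in> V \<Longrightarrow> q \<in> V \<Longrightarrow> d x y = 1 \<Longrightarrow> d p q = 1 \<Longrightarrow>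
      d p x < d p y \<Longrightarrow> d q y < d q x \<Longrightarrow> p = x \<and> q = y"
begin

text \<open>Follow a geodesic from \<open>v\<close> to \<open>w\<close>. While the next vertex
  \<open>z\<close> is still closer to \<open>x\<close>, induction applies to \<open>z\<close>; the
  step that changes sides is the edge \<open>xy\<close> itself by \<open>d_bridge\<close>. So a
  geodesic between the two sides runs through that edge.\<close>

lemma d_cut:
  assumes "x \<in> V" "y \<in> V" "v \<in> V" "w \<in> V" "d x y = 1" "d v x < d v y" "d w y < d w x"
  shows "d v w = d v x + 1 + d y w"
  using assms
proof (induction "d v w" arbitrary: v rule: less_induct)
  case (less v)
  have "v \<noteq> w" using less.prems by auto
  then obtain z where z: "z \<in> V" "d v z = 1" "d v w = Suc (d z w)"
    using d_step less.prems by blast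
  have "d v w \<le> d v x + (d x y + d y w)"
    using d_triangle[of v x w] d_triangle[of x y w] less.prems by linarith
  moreover have "d v x + 1 + d y w \<le> d v w"
  proof (cases "d z x < d z y")
    case True
    then have "d z w = d z x + 1 + d y w" using less z by simp
    then show ?thesis using d_triangle[of v z x] less.prems z by simp
  next
    case False
    then have "d z y < d z x" using d_parity[of x y z] less.prems z by force
    then have "v = x \<and> z = y" using d_bridge less.prems z by blast
    then show ?thesis using z less.prems d_eq_0_iff[of x x] by auto
  qed
  ultimately show ?case using less.prems by linarith
qed

text \<open>If \<open>x\<close> and \<open>y\<close> differ, the edge \<open>xv\<close> separates
  \<open>c\<close>, on the side of \<open>x\<close>, from \<open>y\<close>, on the side of
  \<open>v\<close>. By \<open>d_cut\<close> the vertex \<open>y\<close> is then two steps further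
  from \<open>c\<close> than \<open>x\<close> is, hence further than \<open>v\<close>.\<close>

lemma parent_unique:
  assumes "c \<in> V" "v \<in> V" "x \<in> V" "y \<in> V" "d v x = 1" "d v y = 1" "d c x < d c v" "d c y < d c v"
  shows "x = y"
proof (rule ccontr)
  assume "x \<noteq> y"
  have 1: "d y v = 1" "d x v = 1" using assms d_sym by metis+
  then have "d y x \<noteq> 0" "d y x \<noteq> 1"
    using \<open>x \<noteq> y\<close> d_parity[of x v y] d_eq_0_iff assms by auto
  then have "d c y = d c x + 1 + d v y"
    using d_cut[of x v c y] assms 1 by linarith
  then show False using assms d_triangle[of c x v] 1 by linarith
qed

lemma parent_exists:
  assumes "c \<in> V" "v \<in> V" "v \<noteq> c"
  obtains z where "z \<in> V" "d v z = 1" "d c v = Suc (d c z)"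
  using d_step[of v c] d_sym assms by metis

section \<open>Neighbourhoods, eccentricity, transmission and the degree sum\<close>

definition nbrs :: "'a \<Rightarrow> 'a set" where
  "nbrs v = {u \<in> V. d v u = 1}"

definition ecc :: "'a \<Rightarrow> nat" where
  "ecc v = Max (d v ` V)"

definition transmission :: "'a \<Rightarrow> nat" where
  "transmission v = (\<Sum>u\<in>V. d u v)"

lemma nbrs_subset: "nbrs v \<subseteq> V"
  by (auto simp: nbrs_def)

lemma finite_nbrs [simp]: "finite (nbrs v)"
  by (rule finite_subset[OF nbrs_subset]) simp

lemma nbrs_sym: "u \<in> V \<Longrightarrow> v \<in> nbrs u \<Longrightarrow> u \<in> nbrs v"
  by (auto simp: nbrs_def d_sym)

lemma ecc_ge: "u \<in> V \<Longrightarrow> d v u \<le> ecc v"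
  unfolding ecc_def by simp

lemma ecc_eqI: "u \<in> V \<Longrightarrow> d v u = k \<Longrightarrow> (\<And>w. w \<in> V \<Longrightarrow> d v w \<le> k) \<Longrightarrow> ecc v = k"
  unfolding ecc_def by (intro Max_eqI) auto

lemma ecc_attained:
  assumes "v \<in> V"
  obtains u where "u \<in> V" "d v u = ecc v"
proof -
  have "ecc v \<in> d v ` V" unfolding ecc_def using assms by (intro Max_in) auto
  then show ?thesis using that by auto
qed

text \<open>A tree has one edge less than vertices. Rooted at \<open>c\<close>, every other vertex
  has exactly one neighbour closer to \<open>c\<close>, and swapping the double sum shows that as
  many adjacencies lead away from \<open>c\<close> as towards it.\<close>

lemma sum_degrees:
  assumes c: "c \<in> V"
  shows "(\<Sum>v\<in>V. card (nbrs v)) = 2 * (card V - 1)"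
proof -
  let ?up = "\<lambda>v. {u \<in> V. d v u = 1 \<and> d c u < d c v}"
  let ?down = "\<lambda>v. {u \<in> V. d v u = 1 \<and> d c v < d c u}"
  have up: "card (?up v) = (if v = c then 0 else 1)" if v: "v \<in> V" for v
  proof (cases "v = c")
    case True
    then show ?thesis using d_eq_0_iff[of c c] c by auto
  next
    case False
    obtain z where z: "z \<in> V" "d v z = 1" "d c v = Suc (d c z)"
      using parent_exists[OF c v False] .
    then have "?up v = {z}" using parent_unique[OF c v] by fastforce
    then show ?thesis using False by simp
  qed
  have split: "card (nbrs v) = card (?up v) + card (?down v)" if v: "v \<in> V" for v
  proof -
    have "nbrs v = ?up v \<union> ?down v"
      using d_parity[of v _ c] c v by (fastforce simp: nbrs_def)
    then show ?thesis by (simp add: card_Un_disjoint disjoint_iff)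
  qed
  have "(\<Sum>v\<in>V. card (?down v)) = (\<Sum>v\<in>V. \<Sum>u\<in>V. if d v u = 1 \<and> d c v < d c u then 1 else 0)"
    by (simp flip: sum.inter_filter)
  also have "\<dots> = (\<Sum>u\<in>V. \<Sum>v\<in>V. if d v u = 1 \<and> d c v < d c u then 1 else 0)"
    by (rule sum.swap)
  also have "\<dots> = (\<Sum>u\<in>V. \<Sum>v\<in>V. if d u v = 1 \<and> d c v < d c u then 1 else 0)"
    using d_sym by (intro sum.cong refl) auto
  also have "\<dots> = (\<Sum>u\<in>V. card (?up u))"
    by (simp flip: sum.inter_filter)
  finally have "(\<Sum>v\<in>V. card (nbrs v)) = 2 * (\<Sum>v\<in>V. card (?up v))"
    using split by (simp add: sum.distrib)
  moreover have "(\<Sum>v\<in>V. card (?up v)) = (\<Sum>v\<in>V. if v = c then 0 else 1)"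
    using up by (intro sum.cong) auto
  moreover have "\<dots> = card V - 1"
    using c by (simp add: sum.remove[of V c])
  ultimately show ?thesis by simp
qed

end

section \<open>Distances in graph-theoretic trees\<close>

context graph
begin

lemma graph_dist_le: "awalk u p v \<Longrightarrow> graph_dist G u v \<le> length p"
  unfolding graph_dist_def by (rule Least_le) auto

lemma graph_dist_attained:
  assumes "connected G" "u \<in> verts G" "v \<in> verts G"
  obtains p where "awalk u p v" "length p = graph_dist G u v"
proof -
  have "u \<rightarrow>\<^sup>*\<^bsub>G\<^esub> v"
    using symmetric_connected_imp_strongly_connected[OF sym_arcs assms(1)] assms
    by (auto simp: strongly_connected_def)
  then have "\<exists>k p. awalk u p v \<and> length p = k" using reachable_awalk by auto
  then have "\<exists>p. awalk u p v \<and> length p = graph_dist G u v"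
    unfolding graph_dist_def by (rule LeastI_ex)
  then show ?thesis using that by blast
qed

lemma opposite_arc:
  assumes "a \<in> arcs G"
  obtains b where "b \<in> arcs G" "tail G b = head G a" "head G b = tail G a"
  using sym_arcs assms unfolding symmetric_conv by metis

lemma awalk_reverse: "awalk u p v \<Longrightarrow> \<exists>q. awalk v q u \<and> length q = length p"
proof (induction p arbitrary: u)
  case (Cons a p)
  then have a: "a \<in> arcs G" "tail G a = u" "awalk (head G a) p v" by (auto simp: awalk_Cons_iff)
  obtain q where "awalk v q (head G a)" "length q = length p" using Cons.IH a by blast
  moreover obtain b where "b \<in> arcs G" "tail G b = head G a" "head G b = tail G a"
    using opposite_arc a by blast
  then have "awalk (head G a) [b] u" using a arc_implies_awalk by metis
  ultimately show ?case by (intro exI[of _ "q @ [b]"]) auto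
qed (auto simp: awalk_Nil_iff)

text \<open>Every edge of a tree is a bridge. A path joining the ends of \<open>a\<close> without
  using \<open>a\<close> has at least two arcs, since an empty path would make \<open>a\<close> a
  loop and a single arc would be parallel to \<open>a\<close>. The opposite arc closes such a path
  to a forbidden cycle.\<close>

lemma tree_walk_uses_edge:
  assumes acyclic: "\<nexists>p. cycle p \<and> 3 \<le> length p"
    and a: "a \<in> arcs G" and p: "awalk (tail G a) p (head G a)"
  shows "a \<in> set p"
proof (rule ccontr)
  assume na: "a \<notin> set p"
  define q where "q = awalk_to_apath p"
  have q: "apath (tail G a) q (head G a)"
    unfolding q_def using p by (rule apath_awalk_to_apath)
  have aq: "a \<notin> set q" using awalk_to_apath_subset[OF p] na by (auto simp: q_def)
  have aw: "awalk (tail G a) q (head G a)" using q by (rule awalkI_apath)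
  have "2 \<le> length q"
  proof (rule ccontr)
    assume "\<not> 2 \<le> length q"
    then consider "q = []" | e where "q = [e]" by (cases q) (auto simp: not_le)
    then show False
    proof cases
      case 1
      then show False using aw no_loops[OF a] by (auto simp: awalk_Nil_iff)
    next
      case 2
      then have "e \<in> arcs G" "arc_to_ends G e = arc_to_ends G a"
        using aw by (auto simp: awalk_simps arc_to_ends_def)
      then show False using no_multi_arcs[of e a] a aq 2 by auto
    qed
  qed
  moreover obtain b where b: "b \<in> arcs G" "tail G b = head G a" "head G b = tail G a"
    using opposite_arc[OF a] .
  have "cycle (b # q)"
    unfolding cycle_def using b aw q
    by (intro exI[of _ "head G a"]) (auto simp: awalk_Cons_iff apath_def)
  ultimately show False using acyclic by fastforce
qed

text \<open>Replacing the part of the geodesic before or after \<open>e\<close> by another walk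
  cannot shorten it, so crossing \<open>e\<close> leads away from \<open>u\<close> and towards
  \<open>v\<close>.\<close>

lemma geodesic_arc:
  assumes "connected G" and p: "awalk u p v" "length p = graph_dist G u v" and e: "e \<in> set p"
  shows "graph_dist G (head G e) v < graph_dist G (tail G e) v"
    and "graph_dist G u (tail G e) < graph_dist G u (head G e)"
proof -
  obtain q r where qr: "p = q @ e # r" using split_list[OF e] by auto
  then have w: "awalk u q (tail G e)" "awalk (head G e) r v" "e \<in> arcs G"
    using p by (auto simp: awalk_Cons_iff awalk_append_iff)
  have uv: "u \<in> verts G" "v \<in> verts G" using p by auto
  obtain q' where q': "awalk u q' (head G e)" "length q' = graph_dist G u (head G e)"
    using graph_dist_attained[OF assms(1) uv(1) head_in_verts[OF w(3)]] .
  obtain r' where r': "awalk (tail G e) r' v" "length r' = graph_dist G (tail G e) v"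
    using graph_dist_attained[OF assms(1) tail_in_verts[OF w(3)] uv(2)] .
  have "length p \<le> length (q' @ r)" "length p \<le> length (q @ r')"
    using graph_dist_le[OF awalk_appendI[OF q'(1) w(2)]] graph_dist_le[OF awalk_appendI[OF w(1) r'(1)]]
    by (simp_all add: p(2))
  then show "graph_dist G (head G e) v < graph_dist G (tail G e) v"
    "graph_dist G u (tail G e) < graph_dist G u (head G e)"
    using qr q'(2) r'(2) graph_dist_le[OF w(1)] graph_dist_le[OF w(2)] by simp_all
qed

lemma graph_dist_eq_0_iff:
  assumes "connected G" "u \<in> verts G" "v \<in> verts G"
  shows "graph_dist G u v = 0 \<longleftrightarrow> u = v"
proof
  assume "graph_dist G u v = 0"
  then obtain p where "awalk u p v" "length p = 0" using graph_dist_attained[OF assms] by metis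
  then show "u = v" by (simp add: awalk_Nil_iff)
next
  assume "u = v"
  then show "graph_dist G u v = 0" using graph_dist_le[of u "[]" v] assms by (simp add: awalk_Nil_iff)
qed

lemma graph_dist_eq_1_iff:
  assumes "connected G" "u \<in> verts G" "v \<in> verts G"
  shows "graph_dist G u v = 1 \<longleftrightarrow> u \<rightarrow>\<^bsub>G\<^esub> v"
proof
  assume "graph_dist G u v = 1"
  then obtain p where p: "awalk u p v" "length p = 1" using graph_dist_attained[OF assms] by metis
  then obtain a where "p = [a]" by (cases p) auto
  then show "u \<rightarrow>\<^bsub>G\<^esub> v" using p by (auto simp: awalk_simps arcs_ends_conv)
next
  assume uv: "u \<rightarrow>\<^bsub>G\<^esub> v"
  then obtain a where "a \<in> arcs G" "tail G a = u" "head G a = v" by auto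
  then have "awalk u [a] v" using arc_implies_awalk by auto
  from graph_dist_le[OF this] have "graph_dist G u v \<le> 1" by simp
  moreover have "graph_dist G u v \<noteq> 0"
    using uv adj_not_same graph_dist_eq_0_iff[OF assms] by auto
  ultimately show "graph_dist G u v = 1" by linarith
qed

lemma graph_dist_sym:
  assumes "connected G" "u \<in> verts G" "v \<in> verts G"
  shows "graph_dist G u v = graph_dist G v u"
proof -
  have "graph_dist G y x \<le> graph_dist G x y" if xy: "x \<in> verts G" "y \<in> verts G" for x y
  proof -
    obtain p where p: "awalk x p y" "length p = graph_dist G x y"
      using graph_dist_attained[OF assms(1) xy] .
    obtain q where q: "awalk y q x" "length q = length p" using awalk_reverse[OF p(1)] by blast
    show ?thesis using graph_dist_le[OF q(1)] q(2) p(2) by simp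
  qed
  then show ?thesis using assms by (simp add: order_antisym)
qed

text \<open>Acyclicity enters in the last two axioms. A walk pieced together from geodesics must
  contain the given edge by \<open>tree_walk_uses_edge\<close>, and \<open>geodesic_arc\<close> then
  compares the distances of its ends.\<close>

lemma tree_metric_graph_dist:
  assumes conn: "connected G" and acyclic: "\<nexists>p. cycle p \<and> 3 \<le> length p"
  shows "tree_metric (verts G) (graph_dist G)"
proof
  show "finite (verts G)" by simp
next
  fix x y assume xy: "x \<in> verts G" "y \<in> verts G"
  show "graph_dist G x y = 0 \<longleftrightarrow> x = y" using graph_dist_eq_0_iff[OF conn xy] .
  show "graph_dist G x y = graph_dist G y x"
    using graph_dist_sym[OF conn xy] .
  show "\<exists>z\<in>verts G. graph_dist G x z = 1 \<and> graph_dist G x y = Suc (graph_dist G z y)" if "x \<noteq> y"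
  proof -
    obtain p where p: "awalk x p y" "length p = graph_dist G x y"
      using graph_dist_attained[OF conn xy] .
    then obtain a r where a: "p = a # r" using \<open>x \<noteq> y\<close> by (cases p) (auto simp: awalk_Nil_iff)
    then have a': "a \<in> arcs G" "tail G a = x" "awalk (head G a) r y"
      using p by (auto simp: awalk_Cons_iff)
    then have "graph_dist G x (head G a) = 1"
      using graph_dist_eq_1_iff[OF conn, of x "head G a"] xy by (auto simp: arcs_ends_conv)
    moreover have "graph_dist G (head G a) y \<le> length r" using graph_dist_le[OF a'(3)] .
    moreover obtain r' where r': "awalk (head G a) r' y" "length r' = graph_dist G (head G a) y"
      using graph_dist_attained[OF conn head_in_verts[OF a'(1)] xy(2)] .
    have "awalk x (a # r') y" using a' r' by (simp add: awalk_Cons_iff)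
    from graph_dist_le[OF this] have "graph_dist G x y \<le> Suc (graph_dist G (head G a) y)"
      using r' by simp
    ultimately show ?thesis using a a' p by (intro bexI[of _ "head G a"]) simp_all
  qed
next
  fix x y z assume "x \<in> verts G" "y \<in> verts G" "z \<in> verts G"
  then obtain p q where pq: "awalk x p y" "length p = graph_dist G x y"
     "awalk y q z" "length q = graph_dist G y z" by (meson graph_dist_attained[OF conn])
  then show "graph_dist G x z \<le> graph_dist G x y + graph_dist G y z"
    using graph_dist_le[OF awalk_appendI[OF pq(1,3)]] by simp
next
  fix x y v assume xy: "x \<in> verts G" "y \<in> verts G" "v \<in> verts G" "graph_dist G x y = 1"
  then obtain a where a: "a \<in> arcs G" "tail G a = x" "head G a = y"
    using graph_dist_eq_1_iff[OF conn] by auto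
  obtain p q where pq: "awalk x p v" "length p = graph_dist G x v"
     "awalk v q y" "length q = graph_dist G v y" using xy by (meson graph_dist_attained[OF conn])
  \<comment> \<open>If \<open>a\<close> lies on \<open>p\<close>, then \<open>y\<close> is closer to
    \<open>v\<close> than \<open>x\<close> is; if it lies on \<open>q\<close>, then \<open>x\<close>
    is closer.\<close>
  have "awalk x (p @ q) y" using awalk_appendI[OF pq(1,3)] .
  then have "a \<in> set (p @ q)" using tree_walk_uses_edge[OF acyclic a(1)] a(2,3) by metis
  then have "graph_dist G y v < graph_dist G x v \<or> graph_dist G v x < graph_dist G v y"
    using geodesic_arc(1)[OF conn pq(1,2)] geodesic_arc(2)[OF conn pq(3,4)] a by auto
  moreover have "graph_dist G x v = graph_dist G v x" "graph_dist G y v = graph_dist G v y"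
    using graph_dist_sym[OF conn] xy by auto
  ultimately show "graph_dist G v x \<noteq> graph_dist G v y" by linarith
next
  fix x y p q
  assume V: "x \<in> verts G" "y \<in> verts G" "p \<in> verts G" "q \<in> verts G"
    and xy: "graph_dist G x y = 1" and pq: "graph_dist G p q = 1"
    and less: "graph_dist G p x < graph_dist G p y" "graph_dist G q y < graph_dist G q x"
  obtain a where a: "a \<in> arcs G" "tail G a = x" "head G a = y"
    using graph_dist_eq_1_iff[OF conn] xy V by auto
  obtain e where e: "e \<in> arcs G" "tail G e = p" "head G e = q"
    using graph_dist_eq_1_iff[OF conn] pq V by auto
  obtain r s where rs: "awalk x r p" "length r = graph_dist G x p"
     "awalk q s y" "length s = graph_dist G q y" using V by (meson graph_dist_attained[OF conn])
  \<comment> \<open>If \<open>a\<close> were on \<open>r\<close>, then \<open>y\<close> would be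
    closer to \<open>p\<close> than \<open>x\<close> is; if it were on \<open>s\<close>, then
    \<open>x\<close> would be closer to \<open>q\<close> than \<open>y\<close> is. Both are
    excluded, so \<open>a\<close> is \<open>e\<close>.\<close>
  have "awalk x (r @ e # s) y" using rs e by (auto simp: awalk_Cons_iff)
  then have "a \<in> set (r @ e # s)" using tree_walk_uses_edge[OF acyclic a(1)] a(2,3) by metis
  moreover have "graph_dist G x p = graph_dist G p x" "graph_dist G y p = graph_dist G p y"
    using graph_dist_sym[OF conn] V by auto
  then have "a \<notin> set r" "a \<notin> set s"
    using geodesic_arc(1)[OF conn rs(1,2)] geodesic_arc(2)[OF conn rs(3,4)] a less
    by (metis order_less_asym)+
  ultimately show "p = x \<and> q = y" using a e by auto
qed

end

section \<open>Trees of radius at least three\<close>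

text \<open>The cross terms are nonnegative. Applied to degrees minus two and to numbers of children
  minus one, this concentrates the whole surplus at a single vertex.\<close>

lemma sum_square_le_square_sum:
  fixes f :: "'c \<Rightarrow> int"
  assumes "finite A" "\<And>x. x \<in> A \<Longrightarrow> 0 \<le> f x"
  shows "(\<Sum>x\<in>A. (f x)\<^sup>2) \<le> (\<Sum>x\<in>A. f x)\<^sup>2"
  using assms
proof (induction A rule: finite_induct)
  case (insert x F)
  have "0 \<le> f x * sum f F" using insert by (simp add: sum_nonneg)
  then show ?case using insert by (simp add: power2_sum)
qed simp

context tree_metric
begin

section \<open>Dominating sets and leaves\<close>

definition dominating :: "'a set \<Rightarrow> bool" where
  "dominating S \<longleftrightarrow> S \<subseteq> V \<and> (\<forall>v\<in>V - S. \<exists>u\<in>S. d v u = 1)"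

lemma nbrs_nonempty:
  assumes "v \<in> V" "card V \<noteq> 1"
  shows "nbrs v \<noteq> {}"
proof -
  have "V \<noteq> {v}" using assms by auto
  then obtain w where "w \<in> V" "w \<noteq> v" using assms by blast
  then show ?thesis using d_step[of v w] assms by (auto simp: nbrs_def)
qed

text \<open>Each vertex has a neighbour in the other colour class: its parent, or any neighbour in
  the case of \<open>c\<close>.\<close>

lemma dominating_bipartition:
  assumes c: "c \<in> V" and n: "card V \<noteq> 1"
  shows "dominating {v \<in> V. even (d c v)}" "dominating {v \<in> V. odd (d c v)}"
proof -
  have "\<exists>u\<in>V. d v u = 1 \<and> odd (d c u + d c v)" if v: "v \<in> V" for v
  proof (cases "v = c")
    case True
    then obtain u where "u \<in> V" "d c u = 1" using nbrs_nonempty[OF c n] by (auto simp: nbrs_def)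
    then show ?thesis using True d_eq_0_iff[OF c c] by auto
  next
    case False
    then obtain z where "z \<in> V" "d v z = 1" "d c v = Suc (d c z)"
      using parent_exists[OF c v] by blast
    then show ?thesis by auto
  qed
  then show "dominating {v \<in> V. even (d c v)}" "dominating {v \<in> V. odd (d c v)}"
    unfolding dominating_def by fastforce+
qed

text \<open>This is Ore's bound: the two colour classes both dominate and partition the
  vertices.\<close>

lemma twice_domination_number_le:
  assumes n: "card V \<noteq> 1" and \<gamma>: "\<And>S. dominating S \<Longrightarrow> \<gamma> \<le> card S" and "V \<noteq> {}"
  shows "2 * \<gamma> \<le> card V"
proof -
  obtain c where c: "c \<in> V" using assms by auto
  have "V = {v \<in> V. even (d c v)} \<union> {v \<in> V. odd (d c v)}" by auto
  then have "card V = card {v \<in> V. even (d c v)} + card {v \<in> V. odd (d c v)}"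
    by (metis (no_types, lifting) card_Un_disjoint disjoint_iff finite_Un finite_V mem_Collect_eq)
  then show ?thesis using \<gamma>[OF dominating_bipartition(1)[OF c n]] \<gamma>[OF dominating_bipartition(2)[OF c n]]
    by linarith
qed

definition leaves :: "'a set" where
  "leaves = {v \<in> V. card (nbrs v) = 1}"

text \<open>A leaf \<open>v\<close> whose neighbour \<open>u\<close> is also a leaf would leave no
  way to a third vertex \<open>w\<close>: a geodesic from either of them to \<open>w\<close> would
  have to start towards the other.\<close>

lemma dominating_nonleaves:
  assumes "card V \<ge> 3"
  shows "dominating (V - leaves)"
  unfolding dominating_def
proof (intro conjI ballI)
  fix v assume "v \<in> V - (V - leaves)"
  then have v: "v \<in> V" "card (nbrs v) = 1" by (auto simp: leaves_def)
  then obtain u where u: "nbrs v = {u}" by (auto simp: card_Suc_eq)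
  then have uV: "u \<in> V" "d v u = 1" by (auto simp: nbrs_def)
  have "u \<notin> leaves"
  proof
    assume "u \<in> leaves"
    then obtain v' where "nbrs u = {v'}" by (auto simp: leaves_def card_Suc_eq)
    then have u': "nbrs u = {v}" using nbrs_sym[OF v(1), of u] u by auto
    have "\<not> V \<subseteq> {u, v}"
    proof
      assume "V \<subseteq> {u, v}"
      then have "card V \<le> card {u, v}" by (intro card_mono) auto
      then show False using assms by (simp add: card_insert_if split: if_splits)
    qed
    then obtain w where w: "w \<in> V" "w \<noteq> u" "w \<noteq> v" by blast
    obtain y where "y \<in> V" "d v y = 1" "d v w = Suc (d y w)"
      using d_step[OF v(1) w(1)] w by metis
    moreover from this have "y = u" using u nbrs_def[of v] by blast
    moreover obtain z where "z \<in> V" "d u z = 1" "d u w = Suc (d z w)"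
      using d_step[OF uV(1) w(1)] w by metis
    moreover from this have "z = v" using u' nbrs_def[of u] by blast
    ultimately show False by simp
  qed
  then show "\<exists>u\<in>V - leaves. d v u = 1" using uV by auto
qed auto

section \<open>Degrees and the sum of all distances\<close>

text \<open>With \<open>L\<close> leaves, the numbers \<open>deg v - 2\<close> of the non-leaves are
  nonnegative and add up to \<open>L - 2\<close>, so their squares add up to at most
  \<open>(L - 2)\<^sup>2\<close>. Since the non-leaves dominate, \<open>L\<close> is at most
  \<open>m\<close>.\<close>

lemma sum_degree_pairs_le:
  assumes n: "card V \<ge> 3" and \<gamma>: "\<And>S. dominating S \<Longrightarrow> \<gamma> \<le> card S"
  defines "m \<equiv> int (card V) - int \<gamma>"
  assumes m: "m \<ge> 2"
  shows "(\<Sum>v\<in>V. int (card (nbrs v)) * (int (card (nbrs v)) - 1)) \<le> m\<^sup>2 - 3 * m + 2 * int (card V) - 2"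
proof -
  define deg where "deg v = int (card (nbrs v))" for v
  define L where "L = int (card leaves)"
  obtain c where c: "c \<in> V" using n by fastforce
  have sub: "leaves \<subseteq> V" by (auto simp: leaves_def)
  have finL: "finite leaves" using finite_subset[OF sub finite_V] .
  have leaf: "deg v = 1" if "v \<in> leaves" for v using that by (simp add: leaves_def deg_def)
  have ge1: "deg v \<ge> 1" if "v \<in> V" for v
    using nbrs_nonempty[OF that] n by (simp add: deg_def Suc_le_eq card_gt_0_iff)
  have ge2: "deg v - 2 \<ge> 0" if "v \<in> V - leaves" for v
    using ge1[of v] that by (auto simp: leaves_def deg_def)
  have total: "(\<Sum>v\<in>V. deg v) = 2 * int (card V) - 2"
    using sum_degrees[OF c] n unfolding deg_def by (simp flip: of_nat_sum add: of_nat_diff)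
  have cV: "int (card (V - leaves)) = int (card V) - L"
    using sub finL card_mono[OF finite_V sub] by (simp add: L_def card_Diff_subset of_nat_diff)
  have "(\<Sum>v\<in>V. deg v) = (\<Sum>v\<in>V - leaves. deg v) + (\<Sum>v\<in>leaves. deg v)"
    by (rule sum.subset_diff[OF sub]) simp
  moreover have "(\<Sum>v\<in>leaves. deg v) = L" using leaf by (simp add: L_def)
  ultimately have excess: "(\<Sum>v\<in>V - leaves. deg v - 2) = L - 2"
    using total cV by (simp add: sum_subtractf)
  have "0 \<le> (\<Sum>v\<in>V - leaves. deg v - 2)" using ge2 by (intro sum_nonneg) auto
  then have L2: "L \<ge> 2" using excess by simp
  have "(\<Sum>v\<in>V. deg v * (deg v - 1)) = (\<Sum>v\<in>V - leaves. deg v * (deg v - 1)) + (\<Sum>v\<in>leaves. deg v * (deg v - 1))"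
    by (rule sum.subset_diff[OF sub]) simp
  also have "(\<Sum>v\<in>leaves. deg v * (deg v - 1)) = 0" using leaf by simp
  \<comment> \<open>Expanding around degree two brings in the surplus whose sum is known.\<close>
  also have "(\<Sum>v\<in>V - leaves. deg v * (deg v - 1))
      = (\<Sum>v\<in>V - leaves. (deg v - 2)\<^sup>2 + 3 * (deg v - 2) + 2)"
    by (intro sum.cong refl) (simp add: power2_eq_square algebra_simps)
  also have "\<dots> = (\<Sum>v\<in>V - leaves. (deg v - 2)\<^sup>2) + 3 * (L - 2) + 2 * (int (card V) - L)"
    unfolding excess[symmetric] sum_distrib_left
    by (simp only: sum.distrib sum_constant cV of_nat_mult)
  also have "(\<Sum>v\<in>V - leaves. (deg v - 2)\<^sup>2) \<le> (L - 2)\<^sup>2"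
    unfolding excess[symmetric] using ge2 by (intro sum_square_le_square_sum) auto
  finally have "(\<Sum>v\<in>V. deg v * (deg v - 1)) \<le> L\<^sup>2 - 3 * L + 2 * int (card V) - 2"
    by (simp add: power2_eq_square algebra_simps)
  moreover have "L \<le> m" using \<gamma>[OF dominating_nonleaves[OF n]] cV by (simp add: m_def)
  \<comment> \<open>The product is the difference of \<open>m\<^sup>2 - 3 * m\<close> and
    \<open>L\<^sup>2 - 3 * L\<close>.\<close>
  then have "0 \<le> (m - L) * (m + L - 3)" using L2 m by (cases "m = L") auto
  then have "L\<^sup>2 - 3 * L \<le> m\<^sup>2 - 3 * m" by (simp add: power2_eq_square algebra_simps)
  ultimately show ?thesis unfolding deg_def by linarith
qed

lemma card_distance_two_le:
  assumes v: "v \<in> V"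
  shows "card {u \<in> V. d u v = 2} \<le> (\<Sum>z\<in>nbrs v. card (nbrs z) - 1)"
proof -
  have "{u \<in> V. d u v = 2} \<subseteq> (\<Union>z\<in>nbrs v. nbrs z - {v})"
  proof
    fix u assume u: "u \<in> {u \<in> V. d u v = 2}"
    then have "u \<noteq> v" using d_eq_0_iff[OF v v] by auto
    then obtain z where "z \<in> V" "d v z = 1" "d v u = Suc (d z u)" using d_step[of v u] u v by auto
    then show "u \<in> (\<Union>z\<in>nbrs v. nbrs z - {v})"
      using u v d_sym[of u v] \<open>u \<noteq> v\<close> by (auto simp: nbrs_def)
  qed
  then have "card {u \<in> V. d u v = 2} \<le> card (\<Union>z\<in>nbrs v. nbrs z - {v})" by (intro card_mono) auto
  also have "\<dots> \<le> (\<Sum>z\<in>nbrs v. card (nbrs z - {v}))" by (intro card_UN_le) simp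
  also have "\<dots> = (\<Sum>z\<in>nbrs v. card (nbrs z) - 1)"
    using nbrs_sym[OF v] by (intro sum.cong refl card_Diff_singleton)
  finally show ?thesis .
qed

lemma sum_nbrs: "(\<Sum>z\<in>nbrs v. f z) = (\<Sum>z\<in>V. if d v z = 1 then f z else 0)"
  unfolding nbrs_def by (rule sum.inter_filter) simp

text \<open>Count pairs at distance two by their middle vertex \<open>z\<close>: there are
  \<open>card (nbrs z)\<close> choices for one end and one choice less for the other.\<close>

lemma sum_card_distance_two_le:
  "(\<Sum>v\<in>V. card {u \<in> V. d u v = 2}) \<le> (\<Sum>v\<in>V. card (nbrs v) * (card (nbrs v) - 1))"
proof -
  have "(\<Sum>v\<in>V. card {u \<in> V. d u v = 2}) \<le> (\<Sum>v\<in>V. \<Sum>z\<in>nbrs v. card (nbrs z) - 1)"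
    using card_distance_two_le by (intro sum_mono)
  also have "\<dots> = (\<Sum>v\<in>V. \<Sum>z\<in>V. if d v z = 1 then card (nbrs z) - 1 else 0)"
    by (simp only: sum_nbrs)
  also have "\<dots> = (\<Sum>z\<in>V. \<Sum>v\<in>V. if d v z = 1 then card (nbrs z) - 1 else 0)"
    by (rule sum.swap)
  also have "\<dots> = (\<Sum>z\<in>V. \<Sum>v\<in>V. if d z v = 1 then card (nbrs z) - 1 else 0)"
    using d_sym by (intro sum.cong refl) auto
  also have "\<dots> = (\<Sum>z\<in>V. \<Sum>v\<in>nbrs z. card (nbrs z) - 1)"
    by (simp only: sum_nbrs)
  finally show ?thesis by simp
qed

text \<open>Each distance is at least three, up to deficits of 3, 2 and 1 for the vertex itself, its
  neighbours and the vertices at distance two.\<close>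

lemma transmission_ge:
  assumes v: "v \<in> V"
  shows "3 * card V \<le> transmission v + 2 * card (nbrs v) + card {u \<in> V. d u v = 2} + 3"
proof -
  have "3 * card V = (\<Sum>u\<in>V. 3)" by simp
  also have "\<dots> \<le> (\<Sum>u\<in>V. d u v + (if d v u = 1 then 2 else 0) + (if d u v = 2 then 1 else 0)
      + (if u = v then 3 else 0))"
  proof (intro sum_mono)
    fix u assume "u \<in> V"
    then show "3 \<le> d u v + (if d v u = 1 then 2 else 0) + (if d u v = 2 then 1 else 0)
      + (if u = v then 3 else 0)"
      using d_eq_0_iff[of u v] d_sym[of u v] v by auto
  qed
  also have "\<dots> = transmission v + 2 * card (nbrs v) + card {u \<in> V. d u v = 2} + 3"
    using v by (simp add: sum.distrib transmission_def nbrs_def flip: sum.inter_filter)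
  finally show ?thesis .
qed

lemma sum_transmission_ge:
  assumes n: "card V \<ge> 3" and \<gamma>: "\<And>S. dominating S \<Longrightarrow> \<gamma> \<le> card S"
  defines "m \<equiv> int (card V) - int \<gamma>"
  assumes m: "m \<ge> 2"
  shows "3 * (int (card V))\<^sup>2 - 9 * int (card V) + 6 - m\<^sup>2 + 3 * m \<le> (\<Sum>v\<in>V. int (transmission v))"
proof -
  obtain c where c: "c \<in> V" using n by fastforce
  have "(\<Sum>v\<in>V. 3 * int (card V))
      \<le> (\<Sum>v\<in>V. int (transmission v) + 2 * int (card (nbrs v)) + int (card {u \<in> V. d u v = 2}) + 3)"
  proof (intro sum_mono)
    fix v assume "v \<in> V"
    from transmission_ge[OF this] show "3 * int (card V)
        \<le> int (transmission v) + 2 * int (card (nbrs v)) + int (card {u \<in> V. d u v = 2}) + 3" by linarith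
  qed
  also have "\<dots> = (\<Sum>v\<in>V. int (transmission v)) + 2 * int (\<Sum>v\<in>V. card (nbrs v))
      + int (\<Sum>v\<in>V. card {u \<in> V. d u v = 2}) + 3 * int (card V)"
    by (simp add: sum.distrib flip: sum_distrib_left)
  also have "int (\<Sum>v\<in>V. card (nbrs v)) = 2 * int (card V) - 2"
    using sum_degrees[OF c] n by simp
  also have "int (\<Sum>v\<in>V. card {u \<in> V. d u v = 2})
      \<le> int (\<Sum>v\<in>V. card (nbrs v) * (card (nbrs v) - 1))"
    using sum_card_distance_two_le by (rule of_nat_mono)
  also have "\<dots> = (\<Sum>v\<in>V. int (card (nbrs v)) * (int (card (nbrs v)) - 1))"
    unfolding of_nat_sum
  proof (intro sum.cong refl)
    fix v
    show "int (card (nbrs v) * (card (nbrs v) - 1)) = int (card (nbrs v)) * (int (card (nbrs v)) - 1)"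
      by (cases "card (nbrs v)") (auto simp: algebra_simps)
  qed
  also have "\<dots> \<le> m\<^sup>2 - 3 * m + 2 * int (card V) - 2"
    using sum_degree_pairs_le[OF n \<gamma>] m unfolding m_def by simp
  finally show ?thesis by (simp add: power2_eq_square)
qed

section \<open>Vertices of eccentricity three\<close>

text \<open>Let \<open>z\<close> follow \<open>x\<close> on a geodesic to a non-adjacent
  \<open>y\<close>, and let \<open>w\<close> be at distance at least three from \<open>z\<close>. If
  \<open>w\<close> is on the side of \<open>x\<close>, its geodesic to \<open>y\<close> passes
  through \<open>z\<close> and is longer than three; otherwise \<open>x\<close> is further from
  \<open>w\<close> than \<open>z\<close>, again more than three.\<close>

lemma min_eccentric_adjacent:
  assumes ecc: "\<And>v. v \<in> V \<Longrightarrow> 3 \<le> ecc v"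
    and x: "x \<in> V" "ecc x = 3" and y: "y \<in> V" "ecc y = 3" and "x \<noteq> y"
  shows "d x y = 1"
proof (rule ccontr)
  assume ne: "d x y \<noteq> 1"
  obtain z where z: "z \<in> V" "d x z = 1" "d x y = Suc (d z y)" using d_step x y \<open>x \<noteq> y\<close> by blast
  obtain w where w: "w \<in> V" "3 \<le> d z w" using ecc[OF z(1)] ecc_attained[OF z(1)] by metis
  have wx: "d w x \<le> 3" "d w y \<le> 3" using ecc_ge[OF w(1)] x y d_sym w by metis+
  have zw: "d z w = d w z" "d z y = d y z" "d x y = d y x" using d_sym w z x y by auto
  have yz: "d z y \<ge> 1" using ne z by simp
  consider "d w x < d w z" | "d w z < d w x"
    using d_parity[OF x(1) z(1) w(1) z(2)] by linarith
  then show False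
  proof cases
    case 1
    then have "d w y = d w x + 1 + d z y" using d_cut[of x z w y] x y z w zw by simp
    moreover have "d w z \<le> d w x + d x z" using d_triangle w x z by blast
    ultimately show False using wx w zw yz z by linarith
  next
    case 2
    then show False using wx w zw by linarith
  qed
qed

text \<open>Three such vertices would form a triangle, which \<open>d_parity\<close>
  excludes.\<close>

lemma card_min_eccentric_le:
  assumes ecc: "\<And>v. v \<in> V \<Longrightarrow> 3 \<le> ecc v"
  shows "card {v \<in> V. ecc v = 3} \<le> 2"
proof (rule ccontr)
  assume "\<not> ?thesis"
  then have "3 \<le> card {v \<in> V. ecc v = 3}" by simp
  then obtain A where "A \<subseteq> {v \<in> V. ecc v = 3}" "card A = 3" using obtain_subset_with_card_n by metis
  then obtain x y z where *: "{x, y, z} \<subseteq> {v \<in> V. ecc v = 3}" "x \<noteq> y" "y \<noteq> z" "x \<noteq> z"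
    by (auto simp: card_3_iff)
  then have "d x y = 1" "d z x = 1" "d z y = 1" using min_eccentric_adjacent[OF ecc] by auto
  then show False using d_parity[of x y z] * by auto
qed

definition eds :: nat where
  "eds = (\<Sum>v\<in>V. ecc v * transmission v)"

text \<open>Every eccentricity is counted as four. This overcounts only at the at most two vertices
  in \<open>X\<close>, each time by a transmission of at most
  \<open>3 * (card V - 1)\<close>.\<close>

lemma eds_ge_radius_three:
  assumes ecc: "\<And>v. v \<in> V \<Longrightarrow> 3 \<le> ecc v" and "V \<noteq> {}"
  shows "4 * (\<Sum>v\<in>V. int (transmission v)) - 6 * (int (card V) - 1) \<le> int eds"
proof -
  define X where "X = {v \<in> V. ecc v = 3}"
  have n: "card V \<ge> 1" using assms(2) by (simp add: Suc_le_eq card_gt_0_iff)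
  have small: "int (transmission v) \<le> 3 * (int (card V) - 1)" if v: "v \<in> X" for v
  proof -
    have v': "v \<in> V" "ecc v = 3" using v by (auto simp: X_def)
    have "transmission v = (\<Sum>u\<in>V - {v}. d u v)"
      unfolding transmission_def using v' d_eq_0_iff[of v v] by (simp add: sum.remove[of V v])
    also have "\<dots> \<le> (\<Sum>u\<in>V - {v}. 3)"
      using ecc_ge[of _ v] d_sym v' by (intro sum_mono) force
    finally show ?thesis using v' n by (simp add: card_Diff_singleton of_nat_diff)
  qed
  have "(\<Sum>v\<in>X. int (transmission v)) \<le> (\<Sum>v\<in>X. 3 * (int (card V) - 1))" using small by (rule sum_mono)
  also have "\<dots> = int (card X) * (3 * (int (card V) - 1))" by simp
  also have "\<dots> \<le> 2 * (3 * (int (card V) - 1))"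
    using card_min_eccentric_le[OF ecc] n by (intro mult_right_mono) (auto simp: X_def)
  finally have X: "(\<Sum>v\<in>X. int (transmission v)) \<le> 6 * (int (card V) - 1)" by simp
  have "4 * (\<Sum>v\<in>V. int (transmission v)) - (\<Sum>v\<in>X. int (transmission v))
      = (\<Sum>v\<in>V. 4 * int (transmission v) - (if ecc v = 3 then int (transmission v) else 0))"
    by (simp add: X_def sum_subtractf sum_distrib_left sum.inter_filter)
  also have "\<dots> \<le> (\<Sum>v\<in>V. int (ecc v * transmission v))"
  proof (intro sum_mono)
    fix v assume "v \<in> V"
    then have "ecc v = 3 \<or> 4 \<le> ecc v" using ecc by force
    then show "4 * int (transmission v) - (if ecc v = 3 then int (transmission v) else 0) \<le> int (ecc v * transmission v)"
      using mult_right_mono[of 4 "int (ecc v)" "int (transmission v)"] by auto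
  qed
  finally show ?thesis using X unfolding eds_def by simp
qed

lemma radius_three_bound:
  assumes ecc: "\<And>v. v \<in> V \<Longrightarrow> 3 \<le> ecc v"
    and \<gamma>: "\<And>S. dominating S \<Longrightarrow> \<gamma> \<le> card S" and g3: "3 \<le> \<gamma>" and V: "V \<noteq> {}" "card V \<noteq> 1"
  defines "n \<equiv> int (card V)" and "g \<equiv> int \<gamma>"
  shows "6 * n\<^sup>2 + g\<^sup>2 + 9 * g * n - 22 * n - 28 * g + 34 < int eds"
proof -
  \<comment> \<open>Expressing \<open>n\<close> by \<open>k\<close> and the slack \<open>j\<close>
    of Ore's bound turns the difference of both sides into a polynomial that is visibly positive for
    \<open>k \<ge> 2\<close> and \<open>j \<ge> 0\<close>.\<close>
  define k where "k = g - 1"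
  define j where "j = n - 2 * g"
  have j: "j \<ge> 0" using twice_domination_number_le[OF V(2) \<gamma> V(1)] by (simp add: j_def n_def g_def)
  have k: "k \<ge> 2" using g3 by (simp add: k_def g_def)
  have ng: "n = 2 * k + 2 + j" "g = k + 1" by (simp_all add: k_def j_def)
  have n3: "card V \<ge> 3" using ng k j by (simp add: n_def)
  have "n - g \<ge> 2" using ng k j by simp
  from sum_transmission_ge[OF n3 \<gamma>] this
  have "3 * n\<^sup>2 - 9 * n + 6 - (n - g)\<^sup>2 + 3 * (n - g) \<le> (\<Sum>v\<in>V. int (transmission v))"
    by (simp add: n_def g_def)
  then have "4 * (3 * n\<^sup>2 - 9 * n + 6 - (n - g)\<^sup>2 + 3 * (n - g)) - 6 * (n - 1) \<le> int eds"
    using eds_ge_radius_three[OF ecc V(1)] by (simp add: n_def)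
  moreover have "4 * (3 * n\<^sup>2 - 9 * n + 6 - (n - g)\<^sup>2 + 3 * (n - g)) - 6 * (n - 1)
      = 6 * n\<^sup>2 + g\<^sup>2 + 9 * g * n - 22 * n - 28 * g + 34
        + (k * k + 2 * k - 3 + 7 * (k * j) - j + 2 * (j * j))"
    unfolding ng by (simp add: power2_eq_square algebra_simps)
  moreover have "2 * 2 \<le> k * k" "2 * j \<le> k * j" "0 \<le> j * j"
    using k j mult_mono[of 2 k 2 k] mult_right_mono[of 2 k j] by auto
  ultimately show ?thesis using k j by linarith
qed

end

section \<open>Trees of radius at most two\<close>

locale depth_two_tree = tree_metric +
  fixes c
  assumes c: "c \<in> V" and depth: "\<And>v. v \<in> V \<Longrightarrow> d c v \<le> 2"
begin

section \<open>Levels, parents and distances below the root\<close>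

definition level1 :: "'a set" where "level1 = {v \<in> V. d c v = 1}"
definition level2 :: "'a set" where "level2 = {v \<in> V. d c v = 2}"

definition children :: "'a \<Rightarrow> 'a set" where "children i = {w \<in> level2. d w i = 1}"

definition supports :: "'a set" where "supports = {i \<in> level1. children i \<noteq> {}}"

definition parent :: "'a \<Rightarrow> 'a" where "parent w = (THE i. i \<in> level1 \<and> d w i = 1)"

lemma finite_levels [simp]: "finite level1" "finite level2" "finite (children i)" "finite supports"
  by (simp_all add: level1_def level2_def children_def supports_def)

lemma V_levels: "V = insert c (level1 \<union> level2)"
proof -
  have "v = c \<or> d c v = 1 \<or> d c v = 2" if "v \<in> V" for v
    using depth[OF that] d_eq_0_iff[OF c that] by (auto simp: le_Suc_eq numeral_2_eq_2)
  then show ?thesis using c by (auto simp: level1_def level2_def)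
qed

lemma levels_disjoint: "c \<notin> level1" "c \<notin> level2" "level1 \<inter> level2 = {}"
  using d_eq_0_iff[OF c c] by (auto simp: level1_def level2_def)

lemma level1D: "i \<in> level1 \<Longrightarrow> i \<in> V \<and> d c i = 1 \<and> d i c = 1"
  using d_sym[of c i] c by (auto simp: level1_def)

lemma level2D: "w \<in> level2 \<Longrightarrow> w \<in> V \<and> d c w = 2 \<and> d w c = 2"
  using d_sym[of c w] c by (auto simp: level2_def)

lemma sum_levels: "(\<Sum>v\<in>V. f v) = f c + (\<Sum>v\<in>level1. f v) + (\<Sum>v\<in>level2. f v)"
proof -
  have "(\<Sum>v\<in>V. f v) = f c + (\<Sum>v\<in>level1 \<union> level2. f v)"
    using levels_disjoint by (subst V_levels) simp
  then show ?thesis using levels_disjoint by (simp add: sum.union_disjoint add.assoc)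
qed

lemma card_V: "card V = 1 + card level1 + card level2"
  unfolding card_eq_sum by (subst sum_levels) simp

lemma parent_ex1: "w \<in> level2 \<Longrightarrow> \<exists>!i. i \<in> level1 \<and> d w i = 1"
proof -
  assume w: "w \<in> level2"
  then have w': "w \<in> V" "d c w = 2" "w \<noteq> c" using level2D levels_disjoint by auto
  obtain z where "z \<in> V" "d w z = 1" "d c w = Suc (d c z)" using parent_exists[OF c w'(1,3)] .
  then have "z \<in> level1 \<and> d w z = 1" using w' by (simp add: level1_def)
  moreover have "i = z" if "i \<in> level1 \<and> d w i = 1" for i
    using parent_unique[OF c w'(1), of i z] level1D that calculation w'(2) by simp
  ultimately show ?thesis by blast
qed

lemma parent: "w \<in> level2 \<Longrightarrow> parent w \<in> level1 \<and> d w (parent w) = 1"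
  unfolding parent_def using parent_ex1 by (rule theI')

lemma parent_eqI: "w \<in> level2 \<Longrightarrow> i \<in> level1 \<Longrightarrow> d w i = 1 \<Longrightarrow> parent w = i"
  using parent_ex1 parent by blast

lemma children_eq: "i \<in> level1 \<Longrightarrow> children i = {w \<in> level2. parent w = i}"
  using parent parent_eqI by (auto simp: children_def)

text \<open>The triangle inequality through the root gives the upper bound, and
  \<open>d_parity\<close> rules out the value of the wrong parity.\<close>

lemma d_level1_level1:
  assumes "i \<in> level1" "j \<in> level1"
  shows "d i j = (if i = j then 0 else 2)"
proof -
  have "d i j \<noteq> 1" using d_parity[of i j c] level1D assms c by auto
  moreover have "d i j \<le> 2" using d_triangle[of i c j] level1D assms c by fastforce
  ultimately show ?thesis using d_eq_0_iff[of i j] level1D assms by auto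
qed

lemma d_level2_level1:
  assumes w: "w \<in> level2" and i: "i \<in> level1"
  shows "d w i = (if parent w = i then 1 else 3)" "d i w = (if parent w = i then 1 else 3)"
proof -
  have wi: "w \<in> V" "d c w = 2" "d w c = 2" "i \<in> V" "d c i = 1" "d i c = 1"
    using level1D level2D w i by auto
  have "d w i \<noteq> 2" using d_parity[of c i w] wi c by auto
  moreover have "d w i \<le> 3" using d_triangle[of w c i] wi c by auto
  moreover have "d w i \<noteq> 0" using d_eq_0_iff[of w i] wi by auto
  moreover have "d w i = 1 \<longleftrightarrow> parent w = i" using parent parent_eqI w i by blast
  ultimately show "d w i = (if parent w = i then 1 else 3)" by auto
  then show "d i w = (if parent w = i then 1 else 3)" using d_sym wi by metis
qed

text \<open>For different parents, the edge from the root to \<open>parent w\<close> separates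
  \<open>v\<close> from \<open>w\<close>, and \<open>d_cut\<close> adds up 2 + 1 + 1.\<close>

lemma d_level2_level2:
  assumes v: "v \<in> level2" and w: "w \<in> level2"
  shows "d v w = (if v = w then 0 else if parent v = parent w then 2 else 4)"
proof -
  define y where "y = parent w"
  have y: "y \<in> level1" "y \<in> V" "d c y = 1" "d w y = 1" "d y w = 1"
    using parent[OF w] level1D d_sym[of w y] level2D w by (auto simp: y_def)
  have vw: "v \<in> V" "w \<in> V" "d c v = 2" "d v c = 2" "d c w = 2" "d w c = 2"
    using level2D v w by auto
  consider "v = w" | "v \<noteq> w" "parent v = y" | "parent v \<noteq> y" by (auto simp: y_def)
  then show ?thesis
  proof cases
    case 1
    then show ?thesis using d_eq_0_iff vw by simp
  next
    case 2
    then have "d v y = 1" using d_level2_level1[OF v y(1)] by simp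
    then have "d v w \<le> 2" using d_triangle[of v y w] vw y by simp
    moreover have "d v w \<noteq> 1" using d_parity[of v w c] vw c by auto
    ultimately show ?thesis using d_eq_0_iff[of v w] vw 2 by (auto simp: y_def)
  next
    case 3
    then have "d v y = 3" using d_level2_level1[OF v y(1)] by simp
    then have "d v w = d v c + 1 + d y w" using d_cut[of c y v w] vw y c by simp
    then show ?thesis using vw y 3 by (auto simp: y_def)
  qed
qed

text \<open>Groups the second level by parents. With \<open>f\<close> constant it counts that level;
  with \<open>f\<close> the number of children it produces the sum of squares.\<close>

lemma sum_children: "(\<Sum>w\<in>level2. f (parent w)) = (\<Sum>i\<in>level1. of_nat (card (children i)) * f i)"
  for f :: "'a \<Rightarrow> int"
proof -
  have "(\<Sum>i\<in>level1. of_nat (card (children i)) * f i)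
      = (\<Sum>i\<in>level1. \<Sum>w\<in>{w \<in> level2. parent w = i}. f (parent w))"
    by (intro sum.cong refl) (simp add: children_eq)
  also have "\<dots> = (\<Sum>w\<in>level2. f (parent w))"
    using parent by (intro sum.group) auto
  finally show ?thesis by simp
qed

lemma sum_card_children: "(\<Sum>i\<in>level1. int (card (children i))) = int (card level2)"
  using sum_children[of "\<lambda>_. 1"] by simp

section \<open>Transmissions\<close>

lemma transmission_root: "int (transmission c) = int (card level1) + 2 * int (card level2)"
proof -
  have "(\<Sum>v\<in>level1. d v c) = (\<Sum>v\<in>level1. 1)" "(\<Sum>v\<in>level2. d v c) = (\<Sum>v\<in>level2. 2)"
    using level1D level2D by (intro sum.cong; simp)+
  then show ?thesis unfolding transmission_def sum_levels using d_eq_0_iff[OF c c] by simp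
qed

text \<open>The generic distances from \<open>i\<close> to the two levels are 2 and 3; they drop by
  two for \<open>i\<close> itself and for its children. The root contributes one.\<close>

lemma transmission_level1:
  assumes i: "i \<in> level1"
  shows "int (transmission i)
    = 2 * int (card level1) - 1 + 3 * int (card level2) - 2 * int (card (children i))"
proof -
  have "(\<Sum>v\<in>level1. int (d v i)) = (\<Sum>v\<in>level1. 2 - (if v = i then 2 else 0))"
    using d_level1_level1 i by (intro sum.cong) auto
  also have "\<dots> = 2 * int (card level1) - 2" using i by (simp add: sum_subtractf)
  finally have 1: "(\<Sum>v\<in>level1. int (d v i)) = 2 * int (card level1) - 2" .
  have "(\<Sum>w\<in>level2. int (d w i)) = (\<Sum>w\<in>level2. 3 - (if parent w = i then 2 else 0))"
    using d_level2_level1 i by (intro sum.cong) auto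
  also have "\<dots> = 3 * int (card level2) - 2 * int (card (children i))"
    using i by (simp add: sum_subtractf children_eq flip: sum.inter_filter)
  finally show ?thesis using 1 level1D i by (simp add: transmission_def sum_levels)
qed

text \<open>The generic distances are 3 and 4; they drop by two for the parent and for every vertex
  with the same parent, and by another two for \<open>w\<close> itself.\<close>

lemma transmission_level2:
  assumes w: "w \<in> level2"
  shows "int (transmission w)
    = 3 * int (card level1) - 2 + 4 * int (card level2) - 2 * int (card (children (parent w)))"
proof -
  have p: "parent w \<in> level1" using parent w by simp
  have "(\<Sum>v\<in>level1. int (d v w)) = (\<Sum>v\<in>level1. 3 - (if v = parent w then 2 else 0))"
    using d_level2_level1 w by (intro sum.cong) auto
  also have "\<dots> = 3 * int (card level1) - 2" using p by (simp add: sum_subtractf)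
  finally have 1: "(\<Sum>v\<in>level1. int (d v w)) = 3 * int (card level1) - 2" .
  have "(\<Sum>v\<in>level2. int (d v w))
      = (\<Sum>v\<in>level2. 4 - (if parent v = parent w then 2 else 0) - (if v = w then 2 else 0))"
    using d_level2_level2 w by (intro sum.cong) auto
  also have "\<dots> = 4 * int (card level2) - 2 * int (card (children (parent w))) - 2"
    using w p by (simp add: sum_subtractf children_eq flip: sum.inter_filter)
  finally show ?thesis using 1 level2D w by (simp add: transmission_def sum_levels)
qed

section \<open>Supports, eccentricities and the eccentric distance sum\<close>

text \<open>The root takes care of the first level, and a vertex of the second level makes its own
  parent a support.\<close>

lemma dominating_supports: "dominating (insert c supports)"
  unfolding dominating_def
proof (intro conjI ballI)
  show "insert c supports \<subseteq> V" using c level1D by (auto simp: supports_def)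
  fix v assume "v \<in> V - insert c supports"
  then consider "v \<in> level1" | "v \<in> level2" using V_levels by auto
  then show "\<exists>u\<in>insert c supports. d v u = 1"
  proof cases
    case 2
    then have "v \<in> children (parent v)" using parent by (auto simp: children_def)
    then show ?thesis using parent 2 by (auto simp: supports_def)
  qed (auto dest: level1D)
qed

lemma card_supports_ge: "(\<And>S. dominating S \<Longrightarrow> \<gamma> \<le> card S) \<Longrightarrow> \<gamma> - 1 \<le> card supports"
  using dominating_supports levels_disjoint by (fastforce simp: supports_def)

text \<open>As there are two supports, for each \<open>i\<close> some vertex of the second level has
  a parent other than \<open>i\<close>. It realises the upper bounds 2, 3 and 4 as seen from the
  root, from \<open>i\<close> and from the children of \<open>i\<close>.\<close>

lemma ecc_levels:
  assumes s: "2 \<le> card supports"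
  shows "ecc c = 2" "i \<in> level1 \<Longrightarrow> ecc i = 3" "w \<in> level2 \<Longrightarrow> ecc w = 4"
proof -
  have other: "\<exists>w\<in>level2. parent w \<noteq> i" for i
  proof -
    have "\<not> supports \<subseteq> {i}" using s card_mono[of "{i}" supports] by auto
    then obtain j where "j \<in> supports" "j \<noteq> i" by auto
    then show ?thesis using children_eq by (auto simp: supports_def)
  qed
  show "ecc c = 2" using other depth level2D by (metis ecc_eqI)
  show "ecc i = 3" if i: "i \<in> level1"
  proof -
    obtain w where w: "w \<in> level2" "parent w \<noteq> i" using other by blast
    have "d i v \<le> 3" if "v \<in> V" for v
      using that d_level2_level1(2)[OF _ i] d_level1_level1[OF i] level1D[OF i]
      by (subst (asm) V_levels) auto
    then show ?thesis using w level2D d_level2_level1(2)[OF w(1) i] by (metis ecc_eqI)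
  qed
  show "ecc w = 4" if w: "w \<in> level2"
  proof -
    obtain v where v: "v \<in> level2" "parent v \<noteq> parent w" using other by blast
    have "d w v \<le> 4" if "v \<in> V" for v
      using that d_level2_level1(1)[OF w] d_level2_level2[OF w] level2D[OF w]
      by (subst (asm) V_levels) auto
    moreover have "d w v = 4" using d_level2_level2[OF w v(1)] v by auto
    ultimately show ?thesis using v level2D by (metis ecc_eqI)
  qed
qed

text \<open>The squares come from the second level: the transmission of each child of
  \<open>i\<close> involves the number of children of \<open>i\<close>.\<close>

lemma eds_eq:
  assumes s: "2 \<le> card supports"
  defines "m \<equiv> int (card level1)" and "k \<equiv> int (card level2)"
  shows "int eds = 6 * m\<^sup>2 - m + 21 * m * k + 16 * k\<^sup>2 - 10 * k
    - 8 * (\<Sum>i\<in>level1. (int (card (children i)))\<^sup>2)"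
proof -
  let ?Q = "\<Sum>i\<in>level1. (int (card (children i)))\<^sup>2"
  have "(\<Sum>i\<in>level1. int (ecc i * transmission i))
      = (\<Sum>i\<in>level1. 3 * (2 * m - 1 + 3 * k) - 6 * int (card (children i)))"
    using ecc_levels[OF s] transmission_level1 by (intro sum.cong) (auto simp: m_def k_def)
  also have "\<dots> = m * (3 * (2 * m - 1 + 3 * k)) - 6 * k"
    using sum_card_children by (simp add: sum_subtractf m_def k_def flip: sum_distrib_left)
  finally have 1: "(\<Sum>i\<in>level1. int (ecc i * transmission i)) = m * (3 * (2 * m - 1 + 3 * k)) - 6 * k" .
  have "(\<Sum>w\<in>level2. int (ecc w * transmission w))
      = (\<Sum>w\<in>level2. 4 * (3 * m - 2 + 4 * k) - 8 * int (card (children (parent w))))"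
    using ecc_levels[OF s] transmission_level2 by (intro sum.cong) (auto simp: m_def k_def)
  also have "\<dots> = k * (4 * (3 * m - 2 + 4 * k)) - 8 * (\<Sum>w\<in>level2. int (card (children (parent w))))"
    by (simp add: sum_subtractf k_def flip: sum_distrib_left)
  also have "(\<Sum>w\<in>level2. int (card (children (parent w)))) = ?Q"
    using sum_children[of "\<lambda>i. int (card (children i))"] by (simp add: power2_eq_square)
  finally have 2: "(\<Sum>w\<in>level2. int (ecc w * transmission w))
      = k * (4 * (3 * m - 2 + 4 * k)) - 8 * ?Q" .
  have "int eds = int (ecc c * transmission c) + (\<Sum>i\<in>level1. int (ecc i * transmission i))
      + (\<Sum>w\<in>level2. int (ecc w * transmission w))"
    unfolding eds_def of_nat_sum by (rule sum_levels)
  also have "int (ecc c * transmission c) = 2 * (m + 2 * k)"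
    using ecc_levels(1)[OF s] transmission_root by (simp add: m_def k_def)
  finally show ?thesis unfolding 1 2 by (simp add: power2_eq_square algebra_simps)
qed

text \<open>Give each support one child. The remaining children,
  \<open>card level2 - card supports\<close> in number, contribute most when they share a single
  parent.\<close>

lemma sum_square_children_le:
  "(\<Sum>i\<in>level1. (int (card (children i)))\<^sup>2)
    \<le> (int (card level2) - int (card supports) + 1)\<^sup>2 + int (card supports) - 1"
proof -
  define a where "a i = int (card (children i))" for i
  have sub: "supports \<subseteq> level1" by (auto simp: supports_def)
  have zero: "a i = 0" if "i \<in> level1 - supports" for i using that by (auto simp: supports_def a_def)
  have pos: "a i - 1 \<ge> 0" if "i \<in> supports" for i
    using that by (auto simp: supports_def a_def Suc_le_eq card_gt_0_iff)
  have k: "(\<Sum>i\<in>supports. a i - 1) = int (card level2) - int (card supports)"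
    using sum.mono_neutral_left[of level1 supports a] sub zero sum_card_children
    by (simp add: sum_subtractf a_def)
  have "(\<Sum>i\<in>level1. (a i)\<^sup>2) = (\<Sum>i\<in>supports. (a i)\<^sup>2)"
    using sub zero by (intro sum.mono_neutral_right) auto
  also have "\<dots> = (\<Sum>i\<in>supports. (a i - 1)\<^sup>2 + 2 * (a i - 1) + 1)"
    by (intro sum.cong refl) (simp add: power2_eq_square algebra_simps)
  also have "\<dots> = (\<Sum>i\<in>supports. (a i - 1)\<^sup>2) + 2 * (\<Sum>i\<in>supports. a i - 1) + int (card supports)"
    unfolding sum_distrib_left by (subst sum.distrib)+ simp
  also have "(\<Sum>i\<in>supports. (a i - 1)\<^sup>2) \<le> (\<Sum>i\<in>supports. a i - 1)\<^sup>2"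
    using pos by (intro sum_square_le_square_sum) auto
  finally show ?thesis unfolding k unfolding a_def by (simp add: power2_eq_square algebra_simps)
qed

lemma card_supports_le: "card supports \<le> card level1"
  by (intro card_mono) (auto simp: supports_def)

lemma card_supports_le_level2: "card supports \<le> card level2"
proof -
  have "supports \<subseteq> parent ` level2" using children_eq by (auto simp: supports_def)
  then have "card supports \<le> card (parent ` level2)" by (intro card_mono) auto
  also have "\<dots> \<le> card level2" by (rule card_image_le) simp
  finally show ?thesis .
qed

text \<open>
  Let \<open>m\<close> and \<open>k\<close> be the numbers of vertices at distance one and two from the root in the extremal
  tree.  With \<open>t\<close> surplus vertices at distance two the excess over the bound is at least
  \<open>t * (9 * m + 11 * k - 25 - 7 * t)\<close>, and \<open>t \<le> m - k\<close> because there are at least \<open>k\<close> supports.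
\<close>

lemma depth_two_bound:
  assumes g3: "3 \<le> \<gamma>" and \<gamma>: "\<And>S. dominating S \<Longrightarrow> \<gamma> \<le> card S"
  defines "n \<equiv> int (card V)" and "g \<equiv> int \<gamma>"
  defines "B \<equiv> 6 * n\<^sup>2 + g\<^sup>2 + 9 * g * n - 22 * n - 28 * g + 34"
  shows "B \<le> int eds"
    and "int eds = B \<longleftrightarrow> card level2 = \<gamma> - 1 \<and> (\<forall>i\<in>level1. card (children i) \<le> 1)"
proof -
  define k where "k = g - 1"
  \<comment> \<open>The surpluses \<open>t\<close> and \<open>j\<close> are measured against the
    extremal tree; \<open>r\<close> counts the first-level vertices without children.\<close>
  define t where "t = int (card level2) - k"
  define j where "j = int (card supports) - k"
  define r where "r = int (card level1) - int (card supports)"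
  define Q where "Q = (\<Sum>i\<in>level1. (int (card (children i)))\<^sup>2)"
  have k: "k \<ge> 2" using g3 by (simp add: k_def g_def)
  have "\<gamma> - 1 \<le> card supports" using \<gamma> by (rule card_supports_ge)
  then have j: "0 \<le> j" and s: "2 \<le> card supports" using g3 by (simp_all add: j_def k_def g_def)
  have jt: "j \<le> t" using card_supports_le_level2 by (simp add: j_def t_def)
  have r: "0 \<le> r" using card_supports_le by (simp add: r_def)
  have m: "int (card level1) = k + j + r" by (simp add: r_def j_def)
  have k2: "int (card level2) = k + t" by (simp add: t_def)
  have g: "g = k + 1" by (simp add: k_def)
  have n: "n = 1 + (k + j + r) + (k + t)" using card_V m k2 by (simp add: n_def)
  have eds: "int eds = 6 * (k + j + r)\<^sup>2 - (k + j + r) + 21 * (k + j + r) * (k + t)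
      + 16 * (k + t)\<^sup>2 - 10 * (k + t) - 8 * Q"
    using eds_eq[OF s] unfolding m k2 Q_def .
  have Qle: "Q \<le> (t - j + 1)\<^sup>2 + k + j - 1"
    using sum_square_children_le unfolding Q_def k2 by (simp add: j_def add.commute add_diff_eq diff_diff_eq2)
  \<comment> \<open>Additional supports only lower the bound on \<open>Q\<close>, so
    \<open>j = 0\<close> is the worst case.\<close>
  have "(t - j + 1)\<^sup>2 + k + j - 1 = (t + 1)\<^sup>2 + k - 1 - j * (2 * (t - j) + 1 + j)"
    by (simp add: power2_eq_square algebra_simps)
  moreover have "0 \<le> j * (2 * (t - j) + 1 + j)" using j jt by simp
  ultimately have "Q \<le> (t + 1)\<^sup>2 + k - 1" using Qle by linarith
  then have Qle': "0 \<le> 8 * ((t + 1)\<^sup>2 + k - 1 - Q)" by simp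
  have ex: "int eds - B
      = t * (9 * (j + r) + 2 * t + 20 * k - 25) + 8 * ((t + 1)\<^sup>2 + k - 1 - Q)"
    unfolding eds B_def n g by (simp add: power2_eq_square algebra_simps)
  \<comment> \<open>From \<open>k \<ge> 2\<close> follows \<open>20 * k - 25 \<ge> 15\<close>, so
    equality with \<open>B\<close> forces \<open>t = 0\<close> and then
    \<open>Q = k\<close>.\<close>
  have "t * 15 \<le> t * (9 * (j + r) + 2 * t + 20 * k - 25)"
    using j jt r k by (intro mult_left_mono) auto
  from add_mono[OF this Qle'] have lower: "15 * t \<le> int eds - B" unfolding ex by simp
  then show "B \<le> int eds" using j jt by linarith
  \<comment> \<open>For \<open>t = 0\<close> the left side is \<open>Q - k\<close>; the right side
    has nonnegative terms that vanish exactly when every number of children is zero or one.\<close>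
  have sumQ: "Q - (\<Sum>i\<in>level1. int (card (children i)))
      = (\<Sum>i\<in>level1. int (card (children i)) * (int (card (children i)) - 1))"
    unfolding Q_def by (simp add: sum_subtractf power2_eq_square algebra_simps)
  show "int eds = B \<longleftrightarrow> card level2 = \<gamma> - 1 \<and> (\<forall>i\<in>level1. card (children i) \<le> 1)"
  proof
    assume eq: "int eds = B"
    then have t0: "t = 0" using lower j jt by linarith
    then have l2: "card level2 = \<gamma> - 1" using g3 by (simp add: t_def k_def g_def)
    have j0: "j = 0" using j jt t0 by simp
    have Qk: "Q = k" using ex eq t0 by simp
    have nonneg: "0 \<le> int (card (children i)) * (int (card (children i)) - 1)" for i
      by (cases "card (children i)") auto
    have "(\<Sum>i\<in>level1. int (card (children i)) * (int (card (children i)) - 1)) = 0"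
      using sumQ Qk sum_card_children k2 t0 by simp
    then have "\<forall>i\<in>level1. int (card (children i)) * (int (card (children i)) - 1) = 0"
      using nonneg by (subst (asm) sum_nonneg_eq_0_iff) auto
    then show "card level2 = \<gamma> - 1 \<and> (\<forall>i\<in>level1. card (children i) \<le> 1)" using l2 by auto
  next
    assume R: "card level2 = \<gamma> - 1 \<and> (\<forall>i\<in>level1. card (children i) \<le> 1)"
    then have t0: "t = 0" using g3 by (auto simp: t_def k_def g_def)
    have "(\<Sum>i\<in>level1. int (card (children i)) * (int (card (children i)) - 1)) = 0"
    proof (intro sum.neutral ballI)
      fix i assume "i \<in> level1"
      then have "card (children i) \<le> 1" using R by blast
      then have "card (children i) = 0 \<or> card (children i) = 1" by linarith
      then show "int (card (children i)) * (int (card (children i)) - 1) = 0" by auto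
    qed
    then have "Q = k" using sumQ sum_card_children k2 t0 by simp
    then show "int eds = B" using ex t0 by simp
  qed
qed

end

section \<open>The extremal tree\<close>

text \<open>Expresses adjacency by the root, the levels and \<open>parent\<close>, so that a
  labelling can be checked edge by edge.\<close>

lemma (in depth_two_tree) adjacent_iff:
  assumes "u \<in> V" "v \<in> V"
  shows "d u v = 1 \<longleftrightarrow> u = c \<and> v \<in> level1 \<or> v = c \<and> u \<in> level1
    \<or> v \<in> level2 \<and> parent v = u \<or> u \<in> level2 \<and> parent u = v"
proof -
  consider "u = c" | "u \<in> level1" | "u \<in> level2" using V_levels assms(1) by auto
  then show ?thesis
  proof cases
    case 1
    have "parent w \<noteq> c" if "w \<in> level2" for w using parent[OF that] levels_disjoint by auto
    then show ?thesis using 1 levels_disjoint assms by (auto simp: level1_def)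
  next
    case 2
    then have u: "u \<noteq> c" "u \<notin> level2" using levels_disjoint by auto
    consider "v = c" | "v \<in> level1" | "v \<in> level2" using V_levels assms(2) by auto
    then show ?thesis
    proof cases
      case 1
      then show ?thesis using 2 level1D by simp
    next
      case v: 2
      then have "v \<noteq> c" "v \<notin> level2" using levels_disjoint by auto
      then show ?thesis using u d_level1_level1[OF 2 v] by simp
    next
      case v: 3
      then have "v \<noteq> c" "v \<notin> level1" using levels_disjoint by auto
      then show ?thesis using u v d_level2_level1(2)[OF v 2] by simp
    qed
  next
    case 3
    then have u: "u \<noteq> c" "u \<notin> level1" using levels_disjoint by auto
    consider "v = c" | "v \<in> level1" | "v \<in> level2" using V_levels assms(2) by auto
    then show ?thesis
    proof cases
      case 1
      then show ?thesis using 3 u level2D levels_disjoint parent by fastforce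
    next
      case v: 2
      then have "v \<noteq> c" "v \<notin> level2" using levels_disjoint by auto
      then show ?thesis using u 3 d_level2_level1(1)[OF 3 v] by simp
    next
      case v: 3
      then have "v \<noteq> c" "v \<notin> level1" using levels_disjoint by auto
      moreover have "parent v \<noteq> u" "parent u \<noteq> v" using parent 3 v u calculation by metis+
      ultimately show ?thesis using u d_level2_level2[OF 3 v] by simp
    qed
  qed
qed

text \<open>With at most one child each, \<open>parent\<close> is a bijection from the second level
  onto the supports. The root gets label 0, the supports get \<open>1\<close> to
  \<open>\<gamma> - 1\<close>, the other neighbours of the root \<open>\<gamma>\<close> to
  \<open>m\<close>, and a child gets \<open>m\<close> plus the label of its parent.\<close>

lemma (in depth_two_tree) ex_labelling:
  assumes g: "0 < \<gamma>" and k: "card level2 = \<gamma> - 1"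
    and children: "\<And>i. i \<in> level1 \<Longrightarrow> card (children i) \<le> 1"
  shows "\<exists>f. bij_betw f V {0..<card V} \<and> (\<forall>u\<in>V. \<forall>v\<in>V. d u v = 1 \<longleftrightarrow>
    (f u, f v) \<in> extremal_edges (card V) \<gamma> \<union> (extremal_edges (card V) \<gamma>)\<inverse>)"
proof -
  define m where "m = card level1"
  have n: "card V = m + \<gamma>" using card_V k g by (simp add: m_def)
  have "inj_on parent level2"
  proof (rule inj_onI)
    fix v w assume vw: "v \<in> level2" "w \<in> level2" "parent v = parent w"
    then have "v \<in> children (parent w)" "w \<in> children (parent w)"
      using parent[OF vw(1)] parent[OF vw(2)] by (simp_all add: children_def)
    moreover have "card (children (parent w)) \<le> 1" using children parent vw by blast
    ultimately show "v = w" by (simp add: card_le_Suc0_iff_eq)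
  qed
  moreover have "parent ` level2 = supports"
    using children_eq parent by (auto simp: supports_def)
  ultimately have parent_bij: "bij_betw parent level2 supports" by (simp add: bij_betw_def)
  then have s: "card supports = \<gamma> - 1" using bij_betw_same_card k by metis
  have sub: "supports \<subseteq> level1" by (auto simp: supports_def)
  have ms: "\<gamma> - 1 \<le> m" using card_supports_le s by (simp add: m_def)
  obtain g where g: "bij_betw g supports {1..\<gamma> - 1}"
    using finite_same_card_bij[of supports "{1..\<gamma> - 1}"] s by auto
  obtain h where h: "bij_betw h (level1 - supports) {\<gamma>..m}"
    using finite_same_card_bij[of "level1 - supports" "{\<gamma>..m}"] s sub n \<open>0 < \<gamma>\<close>
    by (auto simp: card_Diff_subset m_def)
  define f1 where "f1 v = (if v \<in> supports then g v else h v)" for v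
  define f where "f v = (if v = c then 0 else if v \<in> level1 then f1 v else m + g (parent v))" for v
  have "bij_betw f1 supports {1..\<gamma> - 1}"
    using g by (rule bij_betw_cong[THEN iffD1, rotated]) (simp add: f1_def)
  moreover have "bij_betw f1 (level1 - supports) {\<gamma>..m}"
    using h by (rule bij_betw_cong[THEN iffD1, rotated]) (simp add: f1_def)
  ultimately have "bij_betw f1 (supports \<union> (level1 - supports)) ({1..\<gamma> - 1} \<union> {\<gamma>..m})"
    by (rule bij_betw_combine) auto
  moreover have "supports \<union> (level1 - supports) = level1" using sub by blast
  moreover have "{1..\<gamma> - 1} \<union> {\<gamma>..m} = {1..m}" using ms \<open>0 < \<gamma>\<close> by auto
  ultimately have "bij_betw f1 level1 {1..m}" by simp
  then have f_level1: "bij_betw f level1 {1..m}"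
    by (rule bij_betw_cong[THEN iffD1, rotated]) (use levels_disjoint in \<open>auto simp: f_def\<close>)
  have "bij_betw (\<lambda>w. m + g (parent w)) level2 {m + 1..m + (\<gamma> - 1)}"
  proof -
    have "bij_betw ((+) m) {1..\<gamma> - 1} {m + 1..m + (\<gamma> - 1)}" by simp
    then have "bij_betw ((+) m \<circ> (g \<circ> parent)) level2 {m + 1..m + (\<gamma> - 1)}"
      using bij_betw_trans[OF parent_bij g] bij_betw_trans by blast
    then show ?thesis by (simp add: comp_def)
  qed
  then have f_level2: "bij_betw f level2 {m + 1..m + (\<gamma> - 1)}"
    by (rule bij_betw_cong[THEN iffD1, rotated]) (use levels_disjoint in \<open>auto simp: f_def\<close>)
  have "bij_betw f (level1 \<union> level2) ({1..m} \<union> {m + 1..m + (\<gamma> - 1)})"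
    using f_level1 f_level2 by (rule bij_betw_combine) auto
  moreover have "bij_betw f {c} {0}" by (simp add: f_def)
  ultimately have "bij_betw f (level1 \<union> level2 \<union> {c}) ({1..m} \<union> {m + 1..m + (\<gamma> - 1)} \<union> {0})"
    by (rule bij_betw_combine) auto
  moreover have "level1 \<union> level2 \<union> {c} = V" using V_levels by auto
  moreover have "{1..m} \<union> {m + 1..m + (\<gamma> - 1)} \<union> {0} = {0..<card V}" using n \<open>0 < \<gamma>\<close> by auto
  ultimately have bij: "bij_betw f V {0..<card V}" by simp
  have f0: "f v = 0 \<longleftrightarrow> v = c" if "v \<in> V" for v
    using bij c that by (metis bij_betw_inv_into_left f_def)
  have f1: "f v \<in> {1..m} \<longleftrightarrow> v \<in> level1" if "v \<in> V" for v
  proof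
    assume fv: "f v \<in> {1..m}"
    then have "v \<noteq> c" by (auto simp: f_def)
    moreover have "v \<notin> level2" using f_level2 fv bij_betwE by fastforce
    ultimately show "v \<in> level1" using V_levels that by auto
  qed (use f_level1 bij_betwE in blast)
  have edge: "(f u, f v) \<in> extremal_edges (card V) \<gamma>
      \<longleftrightarrow> u = c \<and> v \<in> level1 \<or> v \<in> level2 \<and> parent v = u" if uv: "u \<in> V" "v \<in> V" for u v
  proof -
    have "(f u = 0 \<and> f v \<in> {1..m}) \<longleftrightarrow> u = c \<and> v \<in> level1" using f0 f1 uv by simp
    moreover have "(f u \<in> {1..\<gamma> - 1} \<and> f v = m + f u) \<longleftrightarrow> v \<in> level2 \<and> parent v = u"
    proof
      assume *: "f u \<in> {1..\<gamma> - 1} \<and> f v = m + f u"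
      then have "v \<notin> level1" "v \<noteq> c" using f1[OF uv(2)] f0[OF uv(2)] by auto
      then have v: "v \<in> level2" using V_levels uv by auto
      then have p: "parent v \<in> supports" using parent_bij bij_betwE by blast
      have "f (parent v) = g (parent v)" using p sub levels_disjoint by (auto simp: f_def f1_def)
      moreover have "f v = m + g (parent v)" using v levels_disjoint by (auto simp: f_def)
      ultimately have "f (parent v) = f u" using * by simp
      then have "parent v = u" using bij parent[OF v] level1D uv by (metis bij_betw_inv_into_left)
      then show "v \<in> level2 \<and> parent v = u" using v by simp
    next
      assume *: "v \<in> level2 \<and> parent v = u"
      then have p: "u \<in> supports" using parent_bij bij_betwE by blast
      have "f u = g u" using p sub levels_disjoint by (auto simp: f_def f1_def)
      moreover have "f v = m + g u" using * levels_disjoint by (auto simp: f_def)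
      ultimately show "f u \<in> {1..\<gamma> - 1} \<and> f v = m + f u" using p g bij_betwE by metis
    qed
    ultimately show ?thesis unfolding extremal_edges_def n by auto
  qed
  have "\<forall>u\<in>V. \<forall>v\<in>V. d u v = 1 \<longleftrightarrow>
    (f u, f v) \<in> extremal_edges (card V) \<gamma> \<union> (extremal_edges (card V) \<gamma>)\<inverse>"
    using edge adjacent_iff by auto
  then show ?thesis using bij by blast
qed

text \<open>The root is the vertex labelled 0, and its neighbours carry the labels \<open>1\<close>
  to \<open>m\<close>. A label above \<open>m\<close> has the form \<open>m + i\<close>, and its
  vertex hangs on the one labelled \<open>i\<close>.\<close>

lemma (in tree_metric) depth_two_of_labelling:
  assumes g: "0 < \<gamma>" "2 * \<gamma> \<le> card V" and bij: "bij_betw f V {0..<card V}"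
    and adj: "\<And>u v. u \<in> V \<Longrightarrow> v \<in> V \<Longrightarrow> d u v = 1 \<longleftrightarrow>
      (f u, f v) \<in> extremal_edges (card V) \<gamma> \<union> (extremal_edges (card V) \<gamma>)\<inverse>"
  obtains c where "depth_two_tree V d c" "card (depth_two_tree.level2 V d c) = \<gamma> - 1"
    "\<And>i. i \<in> depth_two_tree.level1 V d c \<Longrightarrow> card (depth_two_tree.children V d c i) \<le> 1"
proof -
  define m where "m = card V - \<gamma>"
  have m: "\<gamma> \<le> m" "card V = m + \<gamma>" using g by (auto simp: m_def)
  have lab: "\<exists>v\<in>V. f v = j" if "j < card V" for j
  proof -
    have "j \<in> f ` V" using bij that by (auto simp: bij_betw_def)
    then show ?thesis by blast
  qed
  have less: "f v < card V" if "v \<in> V" for v using bij that bij_betwE by fastforce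
  have edges: "(a, b) \<in> extremal_edges (card V) \<gamma>
      \<longleftrightarrow> a = 0 \<and> b \<in> {1..m} \<or> a \<in> {1..\<gamma> - 1} \<and> b = m + a" for a b
    unfolding extremal_edges_def m(2) by auto
  obtain c where root: "c \<in> V" "f c = 0" using lab[of 0] g by auto
  have l1: "d c v = 1 \<longleftrightarrow> f v \<in> {1..m}" if "v \<in> V" for v
    using adj[OF root(1) that] edges root g by auto
  have "d c v \<le> 2" if v: "v \<in> V" for v
  proof -
    consider "f v = 0" | "f v \<in> {1..m}" | "m < f v" by fastforce
    then show ?thesis
    proof cases
      case 1
      then have "v = c" using bij root v by (metis bij_betw_inv_into_left)
      then show ?thesis using d_eq_0_iff[OF root(1) root(1)] by simp
    next
      case 2
      then show ?thesis using l1[OF v] by simp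
    next
      case 3
      define i where "i = f v - m"
      \<comment> \<open>By \<open>2 * \<gamma> \<le> card V\<close> the label \<open>i\<close> does
        not exceed \<open>m\<close>, so it belongs to a neighbour of the root.\<close>
      have i: "f v = m + i" "i \<in> {1..\<gamma> - 1}" "i \<in> {1..m}"
        using 3 less[OF v] m by (auto simp: i_def)
      then have "i < card V" using m assms(1) by simp
      then obtain u where u: "u \<in> V" "f u = i" using lab by blast
      have "d c u = 1" using l1[OF u(1)] u i by simp
      moreover have "d u v = 1" using adj[OF u(1) v] edges[of i "m + i"] u i by simp
      ultimately show ?thesis using d_triangle[OF root(1) u(1) v] by simp
    qed
  qed
  then interpret depth_two_tree V d c using root by unfold_locales auto
  have level1: "level1 = {v \<in> V. f v \<in> {1..m}}" using l1 by (auto simp: level1_def)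
  have "f ` level1 = {1..m}"
  proof
    show "{1..m} \<subseteq> f ` level1"
    proof
      fix j assume j: "j \<in> {1..m}"
      then obtain v where "v \<in> V" "f v = j" using lab[of j] m g by auto
      then show "j \<in> f ` level1" using j level1 by blast
    qed
  qed (auto simp: level1)
  moreover have inj: "inj_on f V" using bij by (simp add: bij_betw_def)
  then have "inj_on f level1" by (rule inj_on_subset) (auto simp: level1)
  ultimately have "card level1 = m" using card_image[of f level1] by simp
  then have "card level2 = \<gamma> - 1" using card_V m by simp
  moreover have "card (children i) \<le> 1" if i: "i \<in> level1" for i
  proof -
    \<comment> \<open>The label of a child is determined by that of its parent, so injectivity of
      \<open>f\<close> leaves at most one child.\<close>
    have "f w = m + f i" if w: "w \<in> children i" for w
    proof -
      have w': "w \<in> level2" "d w i = 1" using w by (auto simp: children_def)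
      then have "w \<notin> level1" "w \<noteq> c" "w \<in> V" using levels_disjoint level2D by auto
      moreover from this have "f w \<noteq> 0" using inj root by (metis inj_onD)
      ultimately have "f w > m" using level1 by auto
      moreover have "i \<in> V" using level1D i by simp
      ultimately show ?thesis
        using adj[OF \<open>w \<in> V\<close> \<open>i \<in> V\<close>] edges w' i level1 m by auto
    qed
    then have "v = w" if "v \<in> children i" "w \<in> children i" for v w
      using that inj by (metis (no_types, lifting) children_def inj_onD level2D mem_Collect_eq)
    then show ?thesis by (simp add: card_le_Suc0_iff_eq)
  qed
  ultimately show ?thesis using that depth_two_tree_axioms by blast
qed

section \<open>Isomorphisms as adjacency-preserving bijections\<close>

text \<open>The arcs of \<open>H\<close> are the pairs of their ends and \<open>G\<close> has no
  parallel arcs, so the map on arcs is determined by the map on vertices.\<close>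

lemma (in graph) digraph_iso_pairs_iff:
  assumes H: "tail H = fst" "head H = snd" "arcs H \<subseteq> verts H \<times> verts H"
  shows "digraph_iso G H \<longleftrightarrow> (\<exists>f. bij_betw f (verts G) (verts H) \<and>
    (\<forall>u\<in>verts G. \<forall>v\<in>verts G. u \<rightarrow>\<^bsub>G\<^esub> v \<longleftrightarrow> (f u, f v) \<in> arcs H))"
proof
  assume "digraph_iso G H"
  then obtain hom where hom: "digraph_isomorphism hom" "H = app_iso hom G"
    unfolding digraph_iso_def by blast
  define f where "f = iso_verts hom"
  have inj: "inj_on f (verts G)" using digraph_isomorphism_inj_on_verts[OF hom(1)] by (simp add: f_def)
  have arc: "iso_arcs hom a = (f (tail G a), f (head G a))" if "a \<in> arcs G" for a
  proof -
    have "fst (iso_arcs hom a) = f (tail G a)" "snd (iso_arcs hom a) = f (head G a)"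
      using iso_verts_tail[OF hom(1) that] iso_verts_head[OF hom(1) that] H hom(2)
      by (simp_all add: f_def)
    then show ?thesis by (simp add: prod_eq_iff)
  qed
  have "arcs H = iso_arcs hom ` arcs G" using hom(2) by simp
  then have arcs: "arcs H = (\<lambda>a. (f (tail G a), f (head G a))) ` arcs G"
    using arc by simp
  have "u \<rightarrow>\<^bsub>G\<^esub> v \<longleftrightarrow> (f u, f v) \<in> arcs H" if "u \<in> verts G" "v \<in> verts G" for u v
  proof
    show "(f u, f v) \<in> arcs H" if "u \<rightarrow>\<^bsub>G\<^esub> v" using that arcs by auto
    assume "(f u, f v) \<in> arcs H"
    then obtain a where "a \<in> arcs G" "f (tail G a) = f u" "f (head G a) = f v" using arcs by auto
    then show "u \<rightarrow>\<^bsub>G\<^esub> v"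
      using inj that by (metis dominatesI arc_to_ends_def head_in_verts inj_onD tail_in_verts)
  qed
  moreover have "bij_betw f (verts G) (verts H)" using inj hom(2) by (simp add: bij_betw_def f_def)
  ultimately show "\<exists>f. bij_betw f (verts G) (verts H) \<and>
    (\<forall>u\<in>verts G. \<forall>v\<in>verts G. u \<rightarrow>\<^bsub>G\<^esub> v \<longleftrightarrow> (f u, f v) \<in> arcs H)" by blast
next
  assume "\<exists>f. bij_betw f (verts G) (verts H) \<and>
    (\<forall>u\<in>verts G. \<forall>v\<in>verts G. u \<rightarrow>\<^bsub>G\<^esub> v \<longleftrightarrow> (f u, f v) \<in> arcs H)"
  then obtain f where f: "inj_on f (verts G)" "f ` verts G = verts H"
    and adj: "\<And>u v. u \<in> verts G \<Longrightarrow> v \<in> verts G \<Longrightarrow> u \<rightarrow>\<^bsub>G\<^esub> v \<longleftrightarrow> (f u, f v) \<in> arcs H"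
    by (auto simp: bij_betw_def)
  define hom where "hom = \<lparr> iso_verts = f, iso_arcs = (\<lambda>a. (f (tail G a), f (head G a))),
    iso_head = snd, iso_tail = fst \<rparr>"
  have "inj_on (\<lambda>a. (f (tail G a), f (head G a))) (arcs G)"
  proof (rule inj_onI)
    fix a b assume ab: "a \<in> arcs G" "b \<in> arcs G"
      "(f (tail G a), f (head G a)) = (f (tail G b), f (head G b))"
    then have "arc_to_ends G a = arc_to_ends G b"
      using f(1) by (simp add: arc_to_ends_def inj_on_eq_iff)
    then show "a = b" using no_multi_arcs ab by blast
  qed
  then have "digraph_isomorphism hom"
    unfolding digraph_isomorphism_def hom_def using f wf_digraph by simp
  moreover have "(\<lambda>a. (f (tail G a), f (head G a))) ` arcs G = arcs H"
  proof
    show "(\<lambda>a. (f (tail G a), f (head G a))) ` arcs G \<subseteq> arcs H"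
    proof
      fix e assume "e \<in> (\<lambda>a. (f (tail G a), f (head G a))) ` arcs G"
      then obtain a where a: "a \<in> arcs G" "e = (f (tail G a), f (head G a))" by auto
      have "tail G a \<rightarrow>\<^bsub>G\<^esub> head G a" using a(1) by (rule dominatesI[rotated]) (simp add: arc_to_ends_def)
      then show "e \<in> arcs H" using a adj by simp
    qed
    show "arcs H \<subseteq> (\<lambda>a. (f (tail G a), f (head G a))) ` arcs G"
    proof
      fix e assume e: "e \<in> arcs H"
      then have "fst e \<in> f ` verts G" "snd e \<in> f ` verts G" using H(3) f(2) by auto
      then obtain u v where uv: "u \<in> verts G" "v \<in> verts G" "e = (f u, f v)"
        by (metis imageE prod.collapse)
      then have "u \<rightarrow>\<^bsub>G\<^esub> v" using adj e by simp
      then show "e \<in> (\<lambda>a. (f (tail G a), f (head G a))) ` arcs G" using uv by auto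
    qed
  qed
  then have "H = app_iso hom G"
    using H f(2) by (intro pre_digraph.equality) (simp_all add: hom_def)
  ultimately show "digraph_iso G H" unfolding digraph_iso_def by blast
qed

lemma (in graph) digraph_iso_extremal_tree_iff:
  assumes "0 < \<gamma>" "\<gamma> \<le> n"
  shows "digraph_iso G (extremal_tree n \<gamma>) \<longleftrightarrow> (\<exists>f. bij_betw f (verts G) {0..<n} \<and>
    (\<forall>u\<in>verts G. \<forall>v\<in>verts G. u \<rightarrow>\<^bsub>G\<^esub> v \<longleftrightarrow>
      (f u, f v) \<in> extremal_edges n \<gamma> \<union> (extremal_edges n \<gamma>)\<inverse>))"
proof -
  have "extremal_edges n \<gamma> \<subseteq> {0..<n} \<times> {0..<n}"
    using assms by (auto simp: extremal_edges_def)
  then show ?thesis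
    using digraph_iso_pairs_iff[of "extremal_tree n \<gamma>"] by (auto simp: extremal_tree_def)
qed

text \<open>The polynomial reflects eccentricities 2, 3 and 4 on the levels of the extremal tree,
  which takes two supports, that is \<open>\<gamma> \<ge> 3\<close>. For \<open>n > 1\<close> and
  \<open>\<gamma>\<close> one or two, the extremal tree itself lies strictly below the polynomial;
  for \<open>n = 1\<close> both are zero.\<close>

theorem theorem2p10:
  fixes T :: "('a, 'b) pre_digraph" and n \<gamma> :: nat
  assumes "0 < n" and "0 < \<gamma>"
    and "3 \<le> \<gamma> \<or> n = 1"
    and "T \<in> trees_with_domination_number n \<gamma>"
  shows "int (eccentric_distance_sum T)
           \<ge> 6 * int n ^ 2 + int \<gamma> ^ 2 + 9 * int \<gamma> * int n - 22 * int n - 28 * int \<gamma> + 34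
       \<and> (int (eccentric_distance_sum T)
             = 6 * int n ^ 2 + int \<gamma> ^ 2 + 9 * int \<gamma> * int n - 22 * int n - 28 * int \<gamma> + 34
           \<longleftrightarrow> digraph_iso T (extremal_tree n \<gamma>))"
proof -
  let ?B = "6 * int n ^ 2 + int \<gamma> ^ 2 + 9 * int \<gamma> * int n - 22 * int n - 28 * int \<gamma> + 34"
  have "graph T" and conn: "connected T"
    and acyclic: "\<nexists>p. pre_digraph.cycle T p \<and> 3 \<le> length p"
    and n: "card (verts T) = n" and dom: "domination_number T = \<gamma>"
    using assms(4) by (auto simp: trees_with_domination_number_def undirected_tree_def)
  interpret graph T by fact
  interpret tree_metric "verts T" "graph_dist T"
    using conn acyclic by (rule tree_metric_graph_dist)
  have adj: "graph_dist T u v = 1 \<longleftrightarrow> u \<rightarrow>\<^bsub>T\<^esub> v" if "u \<in> verts T" "v \<in> verts T" for u v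
    using graph_dist_eq_1_iff[OF conn that] .
  have dominating: "dominating_set T S \<longleftrightarrow> dominating S" for S
    unfolding dominating_set_def dominating_def using adj by blast
  have fin: "finite (card ` {S. dominating_set T S})"
  proof (rule finite_imageI, rule finite_subset)
    show "{S. dominating_set T S} \<subseteq> Pow (verts T)" by (auto simp: dominating_set_def)
  qed simp
  have \<gamma>: "\<gamma> \<le> card S" if "dominating S" for S
    unfolding dom[symmetric] domination_number_def
    by (rule Min_le[OF fin]) (use that dominating in blast)
  have eds: "eccentric_distance_sum T = eds"
    by (simp add: eccentric_distance_sum_def eds_def eccentricity_def ecc_def dist_sum_def
        transmission_def)
  have V: "verts T \<noteq> {}" using assms(1) n by auto
  have "\<gamma> \<le> n" using \<gamma>[of "verts T"] n by (simp add: dominating_def)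
  note iso = digraph_iso_extremal_tree_iff[OF assms(2) this]
  show ?thesis
  proof (cases "n = 1")
    case True
    then have g: "\<gamma> = 1" using \<open>\<gamma> \<le> n\<close> assms(2) by simp
    obtain v where v: "verts T = {v}" using n True by (auto simp: card_1_singleton_iff)
    have "eds = 0" unfolding eds_def transmission_def using d_eq_0_iff[of v v] by (simp add: v)
    moreover have "digraph_iso T (extremal_tree n \<gamma>)"
      unfolding iso using adj_not_same
      by (intro exI[of _ "\<lambda>_. 0"]) (auto simp: v True g bij_betw_def extremal_edges_def)
    ultimately show ?thesis using eds True g by simp
  next
    case False
    then have g3: "3 \<le> \<gamma>" and V1: "card (verts T) \<noteq> 1" using assms(3) n by auto
    have twice: "2 * \<gamma> \<le> card (verts T)" using twice_domination_number_le[OF V1 \<gamma> V] .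
    have labelling: "digraph_iso T (extremal_tree n \<gamma>) \<longleftrightarrow>
      (\<exists>f. bij_betw f (verts T) {0..<card (verts T)} \<and>
        (\<forall>u\<in>verts T. \<forall>v\<in>verts T. graph_dist T u v = 1 \<longleftrightarrow> (f u, f v) \<in>
          extremal_edges (card (verts T)) \<gamma> \<union> (extremal_edges (card (verts T)) \<gamma>)\<inverse>))"
      unfolding iso n using adj by simp
    have iso_depth_two: "\<exists>c. depth_two_tree (verts T) (graph_dist T) c \<and>
        card (depth_two_tree.level2 (verts T) (graph_dist T) c) = \<gamma> - 1 \<and>
        (\<forall>i\<in>depth_two_tree.level1 (verts T) (graph_dist T) c.
          card (depth_two_tree.children (verts T) (graph_dist T) c i) \<le> 1)"
      if isoT: "digraph_iso T (extremal_tree n \<gamma>)"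
    proof -
      obtain f where f: "bij_betw f (verts T) {0..<card (verts T)}"
        "\<And>u v. u \<in> verts T \<Longrightarrow> v \<in> verts T \<Longrightarrow> graph_dist T u v = 1 \<longleftrightarrow> (f u, f v) \<in>
          extremal_edges (card (verts T)) \<gamma> \<union> (extremal_edges (card (verts T)) \<gamma>)\<inverse>"
        using isoT unfolding labelling by blast
      show ?thesis using depth_two_of_labelling[OF assms(2) twice f] by metis
    qed
    show ?thesis
    proof (cases "\<exists>c\<in>verts T. \<forall>v\<in>verts T. graph_dist T c v \<le> 2")
      case True
      then obtain c where "depth_two_tree (verts T) (graph_dist T) c"
        unfolding depth_two_tree_def depth_two_tree_axioms_def using tree_metric_axioms by blast
      \<comment> \<open>Stated for every root, since the root obtained from an isomorphism need not
        be the one chosen above.\<close>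
      have bound: "?B \<le> int eds" "int eds = ?B \<longleftrightarrow>
          card (depth_two_tree.level2 (verts T) (graph_dist T) c) = \<gamma> - 1 \<and>
          (\<forall>i\<in>depth_two_tree.level1 (verts T) (graph_dist T) c.
            card (depth_two_tree.children (verts T) (graph_dist T) c i) \<le> 1)"
        if "depth_two_tree (verts T) (graph_dist T) c" for c
        using depth_two_tree.depth_two_bound[OF that g3 \<gamma>] n by simp_all
      note c = \<open>depth_two_tree (verts T) (graph_dist T) c\<close>
      have "int eds = ?B \<Longrightarrow> digraph_iso T (extremal_tree n \<gamma>)"
        unfolding labelling using depth_two_tree.ex_labelling[OF c assms(2)] bound(2)[OF c] by blast
      moreover have "digraph_iso T (extremal_tree n \<gamma>) \<Longrightarrow> int eds = ?B"
        using iso_depth_two bound(2) by blast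
      ultimately show ?thesis using bound(1)[OF c] eds by auto
    next
      case False
      have "3 \<le> ecc v" if v: "v \<in> verts T" for v
      proof -
        obtain u where "u \<in> verts T" "\<not> graph_dist T v u \<le> 2" using False v by blast
        then show ?thesis using ecc_ge[of u v] by simp
      qed
      then have "?B < int eds" using radius_three_bound[OF _ \<gamma> g3 V V1] n by simp
      \<comment> \<open>An isomorphism would provide a root from which all distances are at most
        two.\<close>
      moreover have "\<not> digraph_iso T (extremal_tree n \<gamma>)"
        using iso_depth_two False depth_two_tree.c depth_two_tree.depth by metis
      ultimately show ?thesis using eds by auto
    qed
  qed
qed

end
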